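(* Let $n\ge3$ and $1\le p<q\le n$, let $\mathcal{H}$ be a Hilbert space, and let $T\in\mathcal{T}^n_{p,q}(\mathcal{H})$. Then for every polynomial $f\in\mathbb{C}[z_1,\ldots,z_n]$, \[ \|f(T)\|_{\mathcal{B}(\mathcal{H})}\le\sup_{\boldsymbol{z}\in\mathbb{D}^n}|f(\boldsymbol{z})|. \]
   Context: $\mathcal{B}(\mathcal{H})$ is the algebra of bounded operators on the Hilbert space $\mathcal{H}$. $\mathcal{T}^m(\mathcal{H})$ is the set of $m$-tuples $(T_1,\ldots,T_m)$ of pairwise commuting contractions ($\|T_i\|\le1$) on $\mathcal{H}$. For $T\in\mathcal{T}^m(\mathcal{H})$ and $\boldsymbol{k}\in\mathbb{Z}_+^m$ write $T^{\boldsymbol{k}}=T_1^{k_1}\cdots T_m^{k_m}$, $T^{*\boldsymbol{k}}=T_1^{*k_1}\cdots T_m^{*k_m}$, $|\boldsymbol{k}|=\sum_i k_i$, and \[ \mathbb{S}_m^{-1}(T,T^* )=\sum_{\boldsymbol{k}\in\{0,1\}^m}(-1)^{|\boldsymbol{k}|}T^{\boldsymbol{k}}T^{*\boldsymbol{k}}. \] Let $\mathbb{S}_m(\mathcal{H})=\{T\in\mathcal{T}^m(\mathcal{H}):\mathbb{S}_m^{-1}(T,T^* )\ge0\}$. A tuple $T\in\mathcal{T}^m(\mathcal{H})$ is pure if $\|T_i^{*r}h\|\to0$ as $r\to\infty$ for all $h\in\mathcal{H}$ and all $i$. For $T\in\mathcal{T}^n(\mathcal{H})$, $\hat{T}_i\in\mathcal{T}^{n-1}(\mathcal{H})$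 denotes the $(n-1)$-tuple obtained from $T$ by removing $T_i$. For $n\ge3$ and $1\le p<q\le n$, \[ \mathcal{T}^n_{p,q}(\mathcal{H})=\{T\in\mathcal{T}^n(\mathcal{H}):\hat{T}_p,\hat{T}_q\in\mathbb{S}_{n-1}(\mathcal{H})\text{ and }\hat{T}_p\text{ is pure}\}. \] *)

theory Defs
  imports "HOL-Analysis.Analysis" "HOL-Library.Poly_Mapping" "HOL-Library.Nonpos_Ints"
begin

text \<open>
  A complex Hilbert space is a complete real inner product space with a compatible complex scalar
  multiplication and a complex inner product (linear in the first argument), whose real part is
  the real inner product. Positive definiteness and the relation between norm and inner product
  are inherited from \<^class>\<open>real_inner\<close>.
\<close>

class chilbert_space = real_inner + complete_space +
  fixes scaleC :: "complex \<Rightarrow> 'a \<Rightarrow> 'a" (infixr \<open>*\<^sub>C\<close> 75)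
    and cinner :: "'a \<Rightarrow> 'a \<Rightarrow> complex"
  assumes scaleC_add_right: "c *\<^sub>C (x + y) = c *\<^sub>C x + c *\<^sub>C y"
    and scaleC_add_left: "(c + d) *\<^sub>C x = c *\<^sub>C x + d *\<^sub>C x"
    and scaleC_scaleC: "c *\<^sub>C d *\<^sub>C x = (c * d) *\<^sub>C x"
    and scaleR_eq_scaleC: "r *\<^sub>R x = complex_of_real r *\<^sub>C x"
    and cinner_add_left: "cinner (x + y) z = cinner x z + cinner y z"
    and cinner_scaleC_left: "cinner (c *\<^sub>C x) y = c * cinner x y"
    and cinner_commute: "cinner x y = cnj (cinner y x)"
    and inner_eq_Re_cinner: "x \<bullet> y = Re (cinner x y)"

definition bounded_clinear :: "('a::chilbert_space \<Rightarrow> 'a) \<Rightarrow> bool" where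
  "bounded_clinear A \<longleftrightarrow> bounded_linear A \<and> (\<forall>c x. A (c *\<^sub>C x) = c *\<^sub>C A x)"

text \<open>For a bounded operator, the adjoint exists by the Riesz representation theorem; it is unique
  because the inner product is nondegenerate.\<close>

definition cadjoint :: "('a::chilbert_space \<Rightarrow> 'a) \<Rightarrow> 'a \<Rightarrow> 'a" where
  "cadjoint A = (THE B. \<forall>x y. cinner (A x) y = cinner x (B y))"

definition positive_op :: "('a::chilbert_space \<Rightarrow> 'a) \<Rightarrow> bool" where
  "positive_op A \<longleftrightarrow> (\<forall>h. cinner (A h) h \<in> \<real>\<^sub>\<ge>\<^sub>0)"

text \<open>
  An \<open>m\<close>-tuple of operators is a function \<open>T\<close> on the natural numbers of which only the values
  \<open>T 1, \<dots>, T m\<close> matter; multi-indices are treated in the same way.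
\<close>

definition commuting_contractions :: "nat \<Rightarrow> (nat \<Rightarrow> 'a::chilbert_space \<Rightarrow> 'a) set" where
  "commuting_contractions m = {T.
     (\<forall>i\<in>{1..m}. bounded_clinear (T i) \<and> onorm (T i) \<le> 1) \<and>
     (\<forall>i\<in>{1..m}. \<forall>j\<in>{1..m}. T i \<circ> T j = T j \<circ> T i)}"

text \<open>The ordered product \<open>T 1 ^^ k 1 \<circ> \<dots> \<circ> T m ^^ k m\<close>.\<close>

definition tuple_power :: "nat \<Rightarrow> (nat \<Rightarrow> 'a \<Rightarrow> 'a) \<Rightarrow> (nat \<Rightarrow> nat) \<Rightarrow> 'a \<Rightarrow> 'a" where
  "tuple_power m T k = foldr (\<circ>) (map (\<lambda>i. T i ^^ k i) [1..<Suc m]) id"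

definition szego_inverse :: "nat \<Rightarrow> (nat \<Rightarrow> 'a::chilbert_space \<Rightarrow> 'a) \<Rightarrow> 'a \<Rightarrow> 'a" where
  "szego_inverse m T = (\<lambda>h. \<Sum>k \<in> {1..m} \<rightarrow>\<^sub>E {0, 1}. (-1) ^ (\<Sum>i=1..m. k i) *\<^sub>R
     tuple_power m T k (tuple_power m (\<lambda>i. cadjoint (T i)) k h))"

definition szego_tuples :: "nat \<Rightarrow> (nat \<Rightarrow> 'a::chilbert_space \<Rightarrow> 'a) set" where
  "szego_tuples m = {T \<in> commuting_contractions m. positive_op (szego_inverse m T)}"

definition pure_tuple :: "nat \<Rightarrow> (nat \<Rightarrow> 'a::chilbert_space \<Rightarrow> 'a) \<Rightarrow> bool" where
  "pure_tuple m T \<longleftrightarrow> T \<in> commuting_contractions m \<and>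
     (\<forall>i\<in>{1..m}. \<forall>h. (\<lambda>r. norm ((cadjoint (T i) ^^ r) h)) \<longlonglongrightarrow> 0)"

text \<open>Deleting the \<open>p\<close>-th entry shifts the later entries down by one, so that an \<open>n\<close>-tuple
  becomes an \<open>(n - 1)\<close>-tuple indexed by \<open>1, \<dots>, n - 1\<close>.\<close>

definition delete_entry :: "nat \<Rightarrow> (nat \<Rightarrow> 'b) \<Rightarrow> nat \<Rightarrow> 'b" where
  "delete_entry p T = (\<lambda>i. if i < p then T i else T (Suc i))"

definition tuples_pq :: "nat \<Rightarrow> nat \<Rightarrow> nat \<Rightarrow> (nat \<Rightarrow> 'a::chilbert_space \<Rightarrow> 'a) set" where
  "tuples_pq n p q = {T \<in> commuting_contractions n.
     delete_entry p T \<in> szego_tuples (n - 1) \<and>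
     delete_entry q T \<in> szego_tuples (n - 1) \<and>
     pure_tuple (n - 1) (delete_entry p T)}"

text \<open>Multivariate polynomials are finitely supported maps from exponent vectors (themselves
  finitely supported) to coefficients; those in the variables \<open>1, \<dots>, n\<close> are singled out below.\<close>

type_synonym cmpoly = "(nat \<Rightarrow>\<^sub>0 nat) \<Rightarrow>\<^sub>0 complex"

definition polynomials_in :: "nat \<Rightarrow> cmpoly set" where
  "polynomials_in n = {f. \<forall>k\<in>Poly_Mapping.keys f. Poly_Mapping.keys k \<subseteq> {1..n}}"

definition poly_value :: "nat \<Rightarrow> cmpoly \<Rightarrow> (nat \<Rightarrow> complex) \<Rightarrow> complex" where
  "poly_value n f z = (\<Sum>k\<in>Poly_Mapping.keys f.
     Poly_Mapping.lookup f k * (\<Prod>i=1..n. z i ^ Poly_Mapping.lookup k i))"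

definition poly_op :: "nat \<Rightarrow> cmpoly \<Rightarrow> (nat \<Rightarrow> 'a::chilbert_space \<Rightarrow> 'a) \<Rightarrow> 'a \<Rightarrow> 'a" where
  "poly_op n f T = (\<lambda>h. \<Sum>k\<in>Poly_Mapping.keys f.
     Poly_Mapping.lookup f k *\<^sub>C tuple_power n T (Poly_Mapping.lookup k) h)"

definition polydisc :: "nat \<Rightarrow> (nat \<Rightarrow> complex) set" where
  "polydisc n = {1..n} \<rightarrow>\<^sub>E ball 0 1"

end

theory Submission imports Defs begin

text \<open>
  Write \<open>B\<^sub>i\<close> for the adjoint of \<open>T\<^sub>i\<close>, and let \<open>P\<close> and \<open>Q\<close> be the hermitian forms of the two inverse
  Szego operators, \<open>P\<close> for the tuple without \<open>T\<^sub>p\<close> and \<open>Q\<close> for the tuple without \<open>T\<^sub>q\<close>. Both are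
  positive semidefinite, and all the geometry of the proof is expressed through them on the given
  Hilbert space: seminorms take the place of square roots of operators and of dilation spaces, and
  truncated sequences that of infinite ones.

  Since the tuple without \<open>T\<^sub>p\<close> is pure, \<open>P\<close> summed over the orbit of \<open>h\<close> under all monomials in the
  \<open>B\<^sub>i\<close>, \<open>i \<noteq> p\<close>, gives \<open>(norm h)\<^sup>2\<close> (\<open>szego_energy\<close>, \<open>energy_tendsto\<close>). The orbit map thus embeds the
  space isometrically into the \<open>P\<close>-square-summable multi-sequences and turns these \<open>B\<^sub>i\<close> into
  backward shifts. What remains is to find an operator on multi-sequences that corresponds to \<open>B\<^sub>p\<close>
  and commutes with the shifts. Expanding the two Szego forms by the variable in which they differ
  gives the exchange identity
  \<open>Q(h) + P(B\<^sub>p h) = P(h) + Q(B\<^sub>q h)\<close>: the map \<open>(h, B\<^sub>q h) \<mapsto> (B\<^sub>p h, h)\<close> preserves \<open>P \<oplus> Q\<close>. An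
  everywhere defined contraction that nearly extends it (\<open>contractive_realisation\<close>) is a linear system
  with input and output measured by \<open>P\<close> and state measured by \<open>Q\<close>; its transfer function is a
  contractive power series in the \<open>q\<close>-th shift alone, and it corresponds to \<open>B\<^sub>p\<close> up to an error that vanishes
  in the limit (\<open>approximate_model_operator\<close>).

  In this model von Neumann's inequality is a matter of freezing variables. A discrete Fourier
  transform in the shift variables replaces the shifts by numbers \<open>w\<^sub>i\<close> of modulus 1
  (\<open>seq_norm_le_symbol\<close>), and the remaining operator by a single contraction depending on \<open>w\<^sub>q\<close>, for
  which the one-variable inequality holds (\<open>von_neumann_one_variable\<close>). The one-variable inequality has
  the same proof: a strict contraction is a backward shift on its own orbits.
\<close>

section \<open>Complex Hilbert spaces\<close>

lemma scaleC_one [simp]: "1 *\<^sub>C (x::'a::chilbert_space) = x"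
  using scaleR_eq_scaleC[of 1 x] by simp

lemma scaleC_zero_left [simp]: "0 *\<^sub>C (x::'a::chilbert_space) = 0"
  using scaleR_eq_scaleC[of 0 x] by simp

lemma scaleC_zero_right [simp]: "c *\<^sub>C (0::'a::chilbert_space) = 0"
  using scaleC_add_right[of c 0 "0::'a"] by simp

lemma scaleC_minus_right: "c *\<^sub>C (- x) = - (c *\<^sub>C (x::'a::chilbert_space))"
  using scaleC_add_right[of c x "-x"] by (simp add: eq_neg_iff_add_eq_0 add.commute)

lemma scaleC_diff_right: "c *\<^sub>C (x - y) = c *\<^sub>C x - c *\<^sub>C (y::'a::chilbert_space)"
  using scaleC_add_right[of c x "-y"] by (simp add: scaleC_minus_right)

lemma scaleC_minus_left: "(- c) *\<^sub>C x = - (c *\<^sub>C (x::'a::chilbert_space))"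
  using scaleC_add_left[of c "-c" x] by (simp add: eq_neg_iff_add_eq_0 add.commute)

lemma scaleC_diff_left: "(c - d) *\<^sub>C x = c *\<^sub>C x - d *\<^sub>C (x::'a::chilbert_space)"
  using scaleC_add_left[of c "-d" x] by (simp add: scaleC_minus_left)

lemma scaleC_sum_right: "c *\<^sub>C (\<Sum>i\<in>S. f i) = (\<Sum>i\<in>S. c *\<^sub>C (f i :: 'a::chilbert_space))"
  by (induction S rule: infinite_finite_induct) (simp_all add: scaleC_add_right)

lemma scaleC_sum_left: "(\<Sum>i\<in>S. f i) *\<^sub>C x = (\<Sum>i\<in>S. f i *\<^sub>C (x :: 'a::chilbert_space))"
  by (induction S rule: infinite_finite_induct) (simp_all add: scaleC_add_left)

text \<open>Several hermitian forms live on the same space below, and they may be degenerate, so that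
  they cannot be instances of an inner product class.\<close>

locale hermitian_form =
  fixes B :: "'a::chilbert_space \<Rightarrow> 'a \<Rightarrow> complex"
  assumes add_left: "B (x + y) z = B x z + B y z"
    and scale_left: "B (c *\<^sub>C x) y = c * B x y"
    and herm: "B x y = cnj (B y x)"
begin

lemma add_right: "B x (y + z) = B x y + B x z"
  by (metis add_left complex_cnj_add herm)

lemma scale_right: "B x (c *\<^sub>C y) = cnj c * B x y"
  by (metis complex_cnj_mult herm scale_left)

lemma zero_left [simp]: "B 0 y = 0" using add_left[of 0 0 y] by simp
lemma zero_right [simp]: "B x 0 = 0" using add_right[of x 0 0] by simp
lemma minus_left: "B (- x) y = - B x y"
  using add_left[of x "-x" y] by (simp add: eq_neg_iff_add_eq_0 add.commute)
lemma minus_right: "B x (- y) = - B x y"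
  using add_right[of x y "-y"] by (simp add: eq_neg_iff_add_eq_0 add.commute)
lemma diff_left: "B (x - y) z = B x z - B y z"
  using add_left[of x "-y" z] by (simp add: minus_left)
lemma diff_right: "B z (x - y) = B z x - B z y"
  using add_right[of z x "-y"] by (simp add: minus_right)
lemma scaleR_left: "B (r *\<^sub>R x) y = r * B x y"
  by (simp add: scaleR_eq_scaleC scale_left)
lemma scaleR_right: "B x (r *\<^sub>R y) = r * B x y"
  by (simp add: scaleR_eq_scaleC scale_right)
lemma sum_left: "B (\<Sum>i\<in>S. f i) y = (\<Sum>i\<in>S. B (f i) y)"
  by (induction S rule: infinite_finite_induct) (simp_all add: add_left)
lemma sum_right: "B y (\<Sum>i\<in>S. f i) = (\<Sum>i\<in>S. B y (f i))"
  by (induction S rule: infinite_finite_induct) (simp_all add: add_right)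
lemma Re_commute: "Re (B x y) = Re (B y x)"
  by (subst herm) simp
lemma diag_real: "Im (B x x) = 0"
  using arg_cong[OF herm[of x x], of Im] by simp

end

interpretation cinner: hermitian_form cinner
  by unfold_locales (rule cinner_add_left cinner_scaleC_left cinner_commute)+

lemma cinner_self: "cinner x x = complex_of_real ((norm x)\<^sup>2)"
proof -
  have "Re (cinner x x) = (norm x)\<^sup>2"
    by (metis inner_eq_Re_cinner power2_norm_eq_inner)
  then show ?thesis
    using cinner.diag_real[of x] by (simp add: complex_eq_iff)
qed

lemma norm_scaleC: "norm (c *\<^sub>C x) = cmod c * norm (x::'a::chilbert_space)"
proof -
  have "complex_of_real ((norm (c *\<^sub>C x))\<^sup>2) = c * cnj c * complex_of_real ((norm x)\<^sup>2)"
    by (simp only: cinner_self[symmetric] cinner.scale_left cinner.scale_right mult_ac)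
  also have "\<dots> = complex_of_real ((cmod c * norm x)\<^sup>2)"
    by (simp add: complex_norm_square[symmetric] power_mult_distrib)
  finally have "(norm (c *\<^sub>C x))\<^sup>2 = (cmod c * norm x)\<^sup>2"
    by (simp only: of_real_eq_iff)
  then show ?thesis
    by (simp add: power2_eq_iff_nonneg)
qed

lemma cmod_cinner_le: "cmod (cinner x y) \<le> norm x * norm y"
proof (cases "cinner x y = 0")
  case False
  \<comment> \<open>Rotating \<open>x\<close> makes the inner product real and positive.\<close>
  define c where "c = cnj (cinner x y) / cmod (cinner x y)"
  have c1: "cmod c = 1"
    using False by (simp add: c_def norm_divide)
  have "c * cinner x y = cmod (cinner x y)"
    using False by (simp add: c_def complex_norm_square[symmetric] mult.commute power2_eq_square
        flip: of_real_mult)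
      (simp add: complex_norm_square[symmetric] power2_eq_square field_simps)
  then have "cmod (cinner x y) = Re (cinner (c *\<^sub>C x) y)"
    by (simp add: cinner.scale_left)
  also have "\<dots> = (c *\<^sub>C x) \<bullet> y" by (simp add: inner_eq_Re_cinner)
  also have "\<dots> \<le> norm (c *\<^sub>C x) * norm y" by (rule norm_cauchy_schwarz)
  finally show ?thesis by (simp add: norm_scaleC c1)
qed simp

definition clinear :: "('a::chilbert_space \<Rightarrow> 'a) \<Rightarrow> bool" where
  "clinear A \<longleftrightarrow> (\<forall>x y. A (x + y) = A x + A y) \<and> (\<forall>c x. A (c *\<^sub>C x) = c *\<^sub>C A x)"

lemma clinearI:
  assumes "\<And>x y. A (x + y) = A x + A y" "\<And>c x. A (c *\<^sub>C x) = c *\<^sub>C A x"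
  shows "clinear A"
  using assms by (simp add: clinear_def)

lemma clinear_add: "clinear A \<Longrightarrow> A (x + y) = A x + A y"
  and clinear_scaleC: "clinear A \<Longrightarrow> A (c *\<^sub>C x) = c *\<^sub>C A x"
  by (simp_all add: clinear_def)

lemma clinear_zero: "clinear A \<Longrightarrow> A 0 = 0"
  using clinear_scaleC[of A 0 0] by simp

lemma clinear_diff: "clinear A \<Longrightarrow> A (x - y) = A x - A y"
  using clinear_add[of A "x - y" y] by (simp add: algebra_simps)

lemma clinear_sum: "clinear A \<Longrightarrow> A (\<Sum>i\<in>S. f i) = (\<Sum>i\<in>S. A (f i))"
  by (induction S rule: infinite_finite_induct) (simp_all add: clinear_zero clinear_add)

lemma clinear_comp: "clinear A \<Longrightarrow> clinear A' \<Longrightarrow> clinear (\<lambda>x. A (A' x))"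
  by (simp add: clinear_def)

lemma clinear_funpow: "clinear A \<Longrightarrow> clinear (A ^^ j)"
  by (induction j) (simp_all add: clinear_def)

section \<open>Coercive forms and adjoints\<close>

text \<open>The minimiser of \<open>S z z - 2 * \<phi> z\<close> represents \<open>\<phi>\<close>. A minimising sequence is Cauchy by the
  parallelogram law, and near-minimality along each line \<open>z + t *\<^sub>R x\<close> passes to the limit.\<close>

lemma coercive_representation:
  fixes S :: "'a::{real_inner,complete_space} \<Rightarrow> 'a \<Rightarrow> real"
  assumes S: "bounded_bilinear S" and sym: "\<And>x y. S x y = S y x"
    and \<phi>: "bounded_linear \<phi>"
    and \<epsilon>: "\<epsilon> > 0" and coercive: "\<And>x. S x x \<ge> \<epsilon> * (norm x)\<^sup>2"
  obtains z where "\<And>x. S z x = \<phi> x"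
proof -
  interpret S: bounded_bilinear S by fact
  interpret \<phi>: bounded_linear \<phi> by fact
  define F where "F z = S z z - 2 * \<phi> z" for z
  obtain d where d: "d > 0" "\<And>x. norm (\<phi> x) \<le> norm x * d"
    using \<phi>.pos_bounded by blast
  have F_lower: "F z \<ge> - d\<^sup>2 / \<epsilon>" for z
  proof -
    have "0 \<le> (\<epsilon> * norm z - d)\<^sup>2 / \<epsilon>" using \<epsilon> by simp
    also have "\<dots> = \<epsilon> * (norm z)\<^sup>2 - 2 * (norm z * d) + d\<^sup>2 / \<epsilon>"
      using \<epsilon> by (simp add: power2_eq_square field_simps)
    also have "\<dots> \<le> F z + d\<^sup>2 / \<epsilon>"
      using coercive[of z] d(2)[of z] by (simp add: F_def abs_le_iff)
    finally show ?thesis by simp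
  qed
  define m where "m = Inf (range F)"
  have bdd: "bdd_below (range F)" using F_lower by (meson bdd_belowI2)
  have m_le: "m \<le> F z" for z unfolding m_def using bdd by (simp add: cInf_lower)
  have "\<exists>z. F z < m + 1 / real (Suc n)" for n
    using cInf_lessD[of "range F" "m + 1 / real (Suc n)"] by (auto simp: m_def)
  then obtain z where z: "\<And>n. F (z n) < m + 1 / real (Suc n)" by metis
  have par: "\<epsilon> * (norm (x - y))\<^sup>2 \<le> 2 * (F x - m) + 2 * (F y - m)" for x y
  proof -
    have "S (x - y) (x - y) = 2 * F x + 2 * F y - 4 * F ((1/2) *\<^sub>R (x + y))"
      by (simp add: F_def S.diff_left S.diff_right S.add_left S.add_right S.scaleR_left
          S.scaleR_right \<phi>.add \<phi>.scaleR sym[of y x] algebra_simps)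
    then show ?thesis using coercive[of "x - y"] m_le[of "(1/2) *\<^sub>R (x + y)"] by simp
  qed
  have "Cauchy z"
  proof (rule metric_CauchyI)
    fix e :: real assume e: "e > 0"
    obtain N where N: "inverse (real (Suc N)) < \<epsilon> * e\<^sup>2 / 4"
      using reals_Archimedean[of "\<epsilon> * e\<^sup>2 / 4"] \<epsilon> e by auto
    show "\<exists>M. \<forall>m\<ge>M. \<forall>n\<ge>M. dist (z m) (z n) < e"
    proof (intro exI allI impI)
      fix i j assume ij: "N \<le> i" "N \<le> j"
      have le: "F (z k) - m < \<epsilon> * e\<^sup>2 / 4" if "N \<le> k" for k
      proof -
        have "1 / real (Suc k) \<le> 1 / real (Suc N)" using that by (simp add: field_simps)
        then show ?thesis using z[of k] N by (simp add: inverse_eq_divide)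
      qed
      have "\<epsilon> * (norm (z i - z j))\<^sup>2 < \<epsilon> * e\<^sup>2"
        using par[of "z i" "z j"] le[OF ij(1)] le[OF ij(2)] by simp
      then have "(norm (z i - z j))\<^sup>2 < e\<^sup>2" using \<epsilon> by simp
      then show "dist (z i) (z j) < e" using e by (simp add: dist_norm power_less_imp_less_base)
    qed
  qed
  then obtain z0 where z0: "z \<longlonglongrightarrow> z0" using Cauchy_convergent convergent_def by blast
  have "S z0 x = \<phi> x" for x
  proof -
    have line: "0 \<le> 2 * t * (S z0 x - \<phi> x) + t\<^sup>2 * S x x" for t
    proof -
      have "- (1 / real (Suc n)) \<le> 2 * t * (S (z n) x - \<phi> x) + t\<^sup>2 * S x x" for n
      proof -
        have "F (z n + t *\<^sub>R x) = F (z n) + (2 * t * (S (z n) x - \<phi> x) + t\<^sup>2 * S x x)"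
          by (simp add: F_def S.add_left S.add_right S.scaleR_left S.scaleR_right \<phi>.add \<phi>.scaleR
              sym[of x "z n"] power2_eq_square algebra_simps)
        then show ?thesis using m_le[of "z n + t *\<^sub>R x"] z[of n] by simp
      qed
      moreover have "(\<lambda>n. 2 * t * (S (z n) x - \<phi> x) + t\<^sup>2 * S x x)
          \<longlonglongrightarrow> 2 * t * (S z0 x - \<phi> x) + t\<^sup>2 * S x x"
        by (intro tendsto_intros S.tendsto z0)
      moreover have "(\<lambda>n. - (1 / real (Suc n))) \<longlonglongrightarrow> 0"
        using tendsto_minus[OF LIMSEQ_inverse_real_of_nat] by (simp add: inverse_eq_divide)
      ultimately show ?thesis by (meson LIMSEQ_le)
    qed
    define w where "w = S z0 x - \<phi> x"
    define s where "s = S x x"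
    have s: "s \<ge> 0" unfolding s_def using coercive[of x] \<epsilon>
      by (meson less_imp_le mult_nonneg_nonneg order_trans zero_le_power2)
    define u where "u = w / (s + 1)"
    have w_eq: "w = u * (s + 1)" using s by (simp add: u_def)
    have "0 \<le> 2 * (- u) * w + (- u)\<^sup>2 * s"
      using line[of "- u"] by (simp add: w_def s_def)
    also have "\<dots> = - (u\<^sup>2 * (s + 2))"
      by (simp add: w_eq power2_eq_square algebra_simps)
    finally have "u\<^sup>2 * (s + 2) \<le> 0" by simp
    then have "u = 0" using s
      by (metis add_nonneg_pos mult_pos_pos not_less zero_less_numeral zero_less_power2)
    then have "w = 0" by (simp add: w_eq)
    then show ?thesis by (simp add: w_def)
  qed
  then show thesis using that by blast
qed

text \<open>The real Riesz vector of \<open>x \<mapsto> Re (cinner (A x) y)\<close> also represents the imaginary part, as one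
  sees by replacing \<open>x\<close> with \<open>\<i> x\<close>.\<close>

lemma cadjoint:
  assumes A: "bounded_clinear A"
  shows "cinner (A x) y = cinner x (cadjoint A y)"
proof -
  have lin: "bounded_linear A" using A by (simp add: bounded_clinear_def)
  have "\<exists>b. \<forall>x. cinner (A x) y = cinner x b" for y
  proof -
    have "bounded_linear (\<lambda>x. A x \<bullet> y)"
      by (rule bounded_linear_compose[OF bounded_linear_inner_left lin])
    then obtain b where b: "\<And>x. b \<bullet> x = A x \<bullet> y"
      using coercive_representation[of inner "\<lambda>x. A x \<bullet> y" 1]
      by (metis bounded_bilinear_inner inner_commute mult_1 power2_norm_eq_inner order_refl
          zero_less_one)
    have re: "Re (cinner (A x) y) = Re (cinner x b)" for x
      using b[of x] by (simp add: inner_commute flip: inner_eq_Re_cinner)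
    have "Im (cinner (A x) y) = Im (cinner x b)" for x
      using re[of "\<i> *\<^sub>C x"] A by (simp add: bounded_clinear_def cinner.scale_left)
    then show ?thesis using re by (auto simp: complex_eq_iff)
  qed
  then obtain C where C: "\<forall>x y. cinner (A x) y = cinner x (C y)" by metis
  have "D = C" if D: "\<forall>x y. cinner (A x) y = cinner x (D y)" for D
  proof
    fix y
    have "cinner (D y - C y) (D y - C y) = 0"
      using C D by (simp add: cinner.diff_right)
    then show "D y = C y" by (simp add: cinner_self)
  qed
  then have "cadjoint A = C" unfolding cadjoint_def using C by (intro the_equality) auto
  then show ?thesis using C by simp
qed

lemma eq_if_cinner_eq: "(\<And>x. cinner x y = cinner x z) \<Longrightarrow> y = (z::'a::chilbert_space)"
proof -
  assume "\<And>x. cinner x y = cinner x z"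
  then have "cinner (y - z) (y - z) = 0" by (simp add: cinner.diff_right)
  then show "y = z" by (simp add: cinner_self)
qed

lemma clinear_cadjoint:
  assumes A: "bounded_clinear A" shows "clinear (cadjoint A)"
  by (intro clinearI; rule eq_if_cinner_eq)
    (simp_all add: cinner.add_right cinner.scale_right flip: cadjoint[OF A])

lemma norm_cadjoint_le:
  assumes A: "bounded_clinear A" and "onorm A \<le> 1" shows "norm (cadjoint A y) \<le> norm y"
proof -
  have le: "norm (A x) \<le> norm x" for x
    using onorm[of A x] A \<open>onorm A \<le> 1\<close> mult_right_mono[of "onorm A" 1 "norm x"]
    by (simp add: bounded_clinear_def)
  have "(norm (cadjoint A y))\<^sup>2 = cmod (cinner (A (cadjoint A y)) y)"
    by (simp add: cadjoint[OF A] cinner_self norm_power)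
  also have "\<dots> \<le> norm (cadjoint A y) * norm y"
    by (meson cmod_cinner_le le mult_right_mono norm_ge_zero order_trans)
  finally show ?thesis
    by (cases "norm (cadjoint A y) = 0") (auto simp: power2_eq_square)
qed

lemma cadjoint_commute:
  assumes "bounded_clinear A" "bounded_clinear A'" and AA': "A \<circ> A' = A' \<circ> A"
  shows "cadjoint A (cadjoint A' y) = cadjoint A' (cadjoint A y)"
  by (rule eq_if_cinner_eq) (metis AA' assms(1,2) cadjoint comp_apply)

section \<open>Positive semidefinite forms\<close>

locale psd_form = hermitian_form +
  assumes nonneg: "0 \<le> Re (B x x)"
begin

definition semi :: "'a \<Rightarrow> real" where "semi x = sqrt (Re (B x x))"

lemma semi_nonneg [simp]: "0 \<le> semi x" by (simp add: semi_def nonneg)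
lemma semi_square: "(semi x)\<^sup>2 = Re (B x x)" by (simp add: semi_def nonneg)
lemma semi_zero [simp]: "semi 0 = 0" by (simp add: semi_def)

text \<open>The form may vanish at \<open>y \<noteq> 0\<close>; then \<open>B (x - t y) (x - t y) \<ge> 0\<close>, being affine in \<open>t\<close>, forces
  \<open>Re (B x y) = 0\<close>.\<close>

lemma cauchy_schwarz: "Re (B x y) \<le> semi x * semi y"
proof -
  have quad: "0 \<le> Re (B x x) - 2 * t * Re (B x y) + t\<^sup>2 * Re (B y y)" for t
    using nonneg[of "x - t *\<^sub>R y"]
    by (simp add: diff_left diff_right scaleR_left scaleR_right Re_commute[of y x]
        power2_eq_square algebra_simps)
  define a b c where "a = Re (B x x)" and "b = Re (B x y)" and "c = Re (B y y)"
  have q: "0 \<le> a - 2 * t * b + t\<^sup>2 * c" for t using quad by (simp add: a_def b_def c_def)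
  have c0: "c \<ge> 0" and a0: "a \<ge> 0" by (simp_all add: a_def c_def nonneg)
  have "b\<^sup>2 \<le> a * c"
  proof (cases "c = 0")
    case True
    have "b = 0"
    proof (rule ccontr)
      assume "b \<noteq> 0"
      then show False using q[of "(a + 1) / (2 * b)"] True by (simp add: field_simps)
    qed
    then show ?thesis using True by simp
  next
    case False
    then show ?thesis using q[of "b / c"] c0 by (simp add: power2_eq_square field_simps)
  qed
  then have "b\<^sup>2 \<le> (sqrt a * sqrt c)\<^sup>2" using a0 c0 by (simp add: power_mult_distrib)
  then have "\<bar>b\<bar> \<le> sqrt a * sqrt c" using a0 c0
    by (metis abs_le_square_iff abs_of_nonneg mult_nonneg_nonneg real_sqrt_ge_zero)
  then show ?thesis by (simp add: semi_def a_def b_def c_def)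
qed

lemma semi_triangle: "semi (x + y) \<le> semi x + semi y"
proof -
  have "(semi (x + y))\<^sup>2 \<le> (semi x + semi y)\<^sup>2"
    using cauchy_schwarz[of x y]
    by (simp add: semi_square power2_sum add_left add_right Re_commute[of y x])
  then show ?thesis by (rule power2_le_imp_le) simp
qed

lemma semi_scaleC: "semi (c *\<^sub>C x) = cmod c * semi x"
proof -
  have "B (c *\<^sub>C x) (c *\<^sub>C x) = (c * cnj c) * B x x"
    by (simp add: scale_left scale_right)
  then have "Re (B (c *\<^sub>C x) (c *\<^sub>C x)) = (cmod c)\<^sup>2 * Re (B x x)"
    by (simp add: complex_norm_square[symmetric] flip: of_real_power)
  then show ?thesis by (simp add: semi_def real_sqrt_mult)
qed

lemma semi_minus: "semi (- x) = semi x"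
  using semi_scaleC[of "-1" x] by (simp add: scaleC_minus_left)

lemma semi_minus_commute: "semi (x - y) = semi (y - x)"
  using semi_minus[of "x - y"] by simp

lemma semi_sum: "semi (\<Sum>i\<in>S. f i) \<le> (\<Sum>i\<in>S. semi (f i))"
proof (induction S rule: infinite_finite_induct)
  case (insert i S)
  then show ?case using semi_triangle[of "f i" "sum f S"] by simp
qed simp_all

lemma semi_le_iff: "semi x \<le> r * semi y \<longleftrightarrow> Re (B x x) \<le> r\<^sup>2 * Re (B y y)" if "0 \<le> r"
proof -
  have "semi x \<le> r * semi y \<longleftrightarrow> (semi x)\<^sup>2 \<le> (r * semi y)\<^sup>2"
    using that by (simp add: abs_le_square_iff[symmetric])
  then show ?thesis by (simp add: power_mult_distrib semi_square)
qed

end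

section \<open>Fourier analysis on a grid of roots of unity\<close>

definition roots :: "nat \<Rightarrow> complex set" where "roots L = {w. w ^ L = 1}"

lemma finite_roots: "0 < L \<Longrightarrow> finite (roots L)"
  and card_roots: "0 < L \<Longrightarrow> card (roots L) = L"
  unfolding roots_def using finite_roots_unity[of L] card_roots_unity_eq[of L] by auto

lemma cmod_roots: "0 < L \<Longrightarrow> w \<in> roots L \<Longrightarrow> cmod w = 1"
  using power_eq_1_iff[of w L] by (auto simp: roots_def)

text \<open>Multiplication by a primitive root permutes the roots of unity and multiplies the sum by a
  factor different from 1.\<close>

lemma roots_orthogonal:
  assumes "k < L" "l < L"
  shows "(\<Sum>w\<in>roots L. w ^ k * cnj (w ^ l)) = (if k = l then of_nat L else 0)"
proof (cases "k = l")
  case True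
  have "w ^ k * cnj (w ^ k) = 1" if "w \<in> roots L" for w
    using cmod_roots[OF _ that] assms
    by (simp flip: complex_norm_square power_mult_distrib)
  then show ?thesis using True assms card_roots[of L] by simp
next
  case False
  have L: "0 < L" using assms by simp
  define \<xi> where "\<xi> = cis (2 * pi / real L)"
  have pow: "\<xi> ^ j = cis (2 * pi * real j / real L)" for j
    by (simp add: \<xi>_def Complex.DeMoivre algebra_simps)
  have "inj_on (\<lambda>j. cis (2 * pi * real j / real L)) {..<L}"
    using Complex.bij_betw_roots_unity[OF L] by (simp add: bij_betw_def)
  then have neq: "\<xi> ^ k \<noteq> \<xi> ^ l"
    using False assms by (auto simp: pow inj_on_def)
  have \<xi>1: "cmod \<xi> = 1" by (simp add: \<xi>_def)
  then have cnj_\<xi>: "\<xi> ^ l * cnj (\<xi> ^ l) = 1"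
    by (simp flip: complex_norm_square power_mult_distrib)
  have \<xi>_root: "\<xi> \<in> roots L" using L by (simp add: roots_def pow)
  have perm: "bij_betw (\<lambda>w. \<xi> * w) (roots L) (roots L)"
  proof (rule bij_betw_imageI)
    show inj: "inj_on ((*) \<xi>) (roots L)" using \<xi>1 by (auto simp: inj_on_def)
    have "(*) \<xi> ` roots L \<subseteq> roots L"
      using \<xi>_root by (auto simp: roots_def power_mult_distrib)
    then show "(*) \<xi> ` roots L = roots L"
      by (simp add: card_image[OF inj] card_subset_eq finite_roots[OF L])
  qed
  define S where "S = (\<Sum>w\<in>roots L. w ^ k * cnj (w ^ l))"
  have "S = (\<Sum>w\<in>roots L. (\<xi> * w) ^ k * cnj ((\<xi> * w) ^ l))"
    unfolding S_def by (rule sum.reindex_bij_betw[OF perm, symmetric])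
  also have "\<dots> = \<xi> ^ k * cnj (\<xi> ^ l) * S"
    by (simp add: S_def sum_distrib_left power_mult_distrib mult_ac)
  finally have S: "S = \<xi> ^ k * cnj (\<xi> ^ l) * S" .
  have "S * \<xi> ^ l = \<xi> ^ k * (\<xi> ^ l * cnj (\<xi> ^ l)) * S"
    by (subst S) (simp only: mult_ac)
  also have "\<dots> = \<xi> ^ k * S" by (simp only: cnj_\<xi> mult_1_right)
  finally have "S * (\<xi> ^ k - \<xi> ^ l) = 0" by (auto simp: algebra_simps)
  then show ?thesis using False neq by (simp add: S_def)
qed

definition grid :: "nat set \<Rightarrow> nat \<Rightarrow> (nat \<Rightarrow> complex) set" where
  "grid I L = I \<rightarrow>\<^sub>E roots L"

text \<open>Multi-indices are extensional functions, so that a box of them is a finite product set and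
  sums over it factorise.\<close>

definition index_box :: "nat set \<Rightarrow> nat \<Rightarrow> (nat \<Rightarrow> nat) set" where
  "index_box I N = I \<rightarrow>\<^sub>E {..<N}"

definition mon :: "nat set \<Rightarrow> (nat \<Rightarrow> complex) \<Rightarrow> (nat \<Rightarrow> nat) \<Rightarrow> complex" where
  "mon I w k = (\<Prod>i\<in>I. w i ^ k i)"

definition fourier_coeff ::
  "nat set \<Rightarrow> nat \<Rightarrow> ((nat \<Rightarrow> complex) \<Rightarrow> 'a::chilbert_space) \<Rightarrow> (nat \<Rightarrow> nat) \<Rightarrow> 'a" where
  "fourier_coeff I L y k = (1 / of_nat L ^ card I) *\<^sub>C (\<Sum>w\<in>grid I L. mon I w k *\<^sub>C y w)"

definition trig_poly ::
  "nat set \<Rightarrow> nat \<Rightarrow> ((nat \<Rightarrow> nat) \<Rightarrow> 'a::chilbert_space) \<Rightarrow> (nat \<Rightarrow> complex) \<Rightarrow> 'a" where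
  "trig_poly I N x w = (\<Sum>k\<in>index_box I N. cnj (mon I w k) *\<^sub>C x k)"

lemma finite_index_box: "finite I \<Longrightarrow> finite (index_box I N)"
  unfolding index_box_def by (intro finite_PiE) auto

lemma index_box_mono: "N \<le> N' \<Longrightarrow> index_box I N \<subseteq> index_box I N'"
  unfolding index_box_def by (intro PiE_mono) auto

lemma mon_orthogonal:
  assumes I: "finite I" and L: "0 < L" and k: "k \<in> index_box I L" and l: "l \<in> index_box I L"
  shows "(\<Sum>w\<in>grid I L. mon I w k * cnj (mon I w l)) = (if k = l then of_nat L ^ card I else 0)"
proof -
  have "(\<Sum>w\<in>grid I L. mon I w k * cnj (mon I w l))
      = (\<Sum>w\<in>grid I L. \<Prod>i\<in>I. w i ^ k i * cnj (w i ^ l i))"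
    by (simp add: mon_def prod.distrib)
  also have "\<dots> = (\<Prod>i\<in>I. \<Sum>w\<in>roots L. w ^ k i * cnj (w ^ l i))"
    unfolding grid_def by (rule prod_sum_PiE[symmetric]) (simp_all add: I finite_roots[OF L])
  also have "\<dots> = (\<Prod>i\<in>I. if k i = l i then of_nat L else 0)"
    using k l by (intro prod.cong refl roots_orthogonal) (auto simp: index_box_def PiE_iff)
  also have "\<dots> = (if k = l then of_nat L ^ card I else 0)"
  proof (cases "k = l")
    case False
    then obtain i where "i \<in> I" "k i \<noteq> l i"
      using k l unfolding index_box_def by (meson PiE_ext)
    then show ?thesis using I False by (auto intro!: prod_zero)
  qed simp
  finally show ?thesis .
qed

lemma fourier_coeff_trig_poly:
  assumes I: "finite I" and N: "N \<le> L" "0 < L" and k: "k \<in> index_box I L"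
    and x: "\<And>k. k \<notin> index_box I N \<Longrightarrow> x k = 0"
  shows "fourier_coeff I L (trig_poly I N x) k = x k"
proof -
  have "(\<Sum>w\<in>grid I L. mon I w k *\<^sub>C trig_poly I N x w)
      = (\<Sum>l\<in>index_box I N. (\<Sum>w\<in>grid I L. mon I w k * cnj (mon I w l)) *\<^sub>C x l)"
    by (simp add: trig_poly_def scaleC_sum_right scaleC_sum_left scaleC_scaleC
        sum.swap[of _ "grid I L"])
  also have "\<dots> = (\<Sum>l\<in>index_box I N. if k = l then of_nat L ^ card I *\<^sub>C x l else 0)"
    using k index_box_mono[OF N(1), of I] by (intro sum.cong refl) (simp add: mon_orthogonal I N subsetD)
  also have "\<dots> = of_nat L ^ card I *\<^sub>C x k"
    using x[of k] finite_index_box[OF I, of N] by (simp add: sum.delta')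
  finally show ?thesis using N by (simp add: fourier_coeff_def scaleC_scaleC)
qed

lemma Re_of_nat_power_mult: "Re (of_nat L ^ j * z) = real L ^ j * Re z"
proof -
  have "of_nat L ^ j * z = complex_of_real (real L ^ j) * z" by simp
  then show ?thesis by (simp del: of_real_power)
qed

context psd_form
begin

lemma inner_trig_poly:
  assumes "N \<le> L" "0 < L"
  shows "(\<Sum>w\<in>grid I L. B (y w) (trig_poly I N x w))
    = of_nat L ^ card I * (\<Sum>k\<in>index_box I N. B (fourier_coeff I L y k) (x k))"
proof -
  have "(\<Sum>w\<in>grid I L. B (y w) (trig_poly I N x w))
      = (\<Sum>w\<in>grid I L. \<Sum>k\<in>index_box I N. mon I w k * B (y w) (x k))"
    by (simp add: trig_poly_def sum_right scale_right)
  also have "\<dots> = (\<Sum>k\<in>index_box I N. \<Sum>w\<in>grid I L. mon I w k * B (y w) (x k))"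
    by (rule sum.swap)
  also have "\<dots> = (\<Sum>k\<in>index_box I N. of_nat L ^ card I * B (fourier_coeff I L y k) (x k))"
    using assms by (simp add: fourier_coeff_def sum_left scale_left)
  finally show ?thesis by (simp add: sum_distrib_left)
qed

lemma parseval:
  assumes I: "finite I" and N: "N \<le> L" "0 < L"
  shows "(\<Sum>w\<in>grid I L. (semi (trig_poly I N x w))\<^sup>2)
    = real L ^ card I * (\<Sum>k\<in>index_box I N. (semi (x k))\<^sup>2)"
proof -
  define x' where "x' k = (if k \<in> index_box I N then x k else 0)" for k
  have eq: "trig_poly I N x = trig_poly I N x'"
    by (auto simp: trig_poly_def x'_def intro!: sum.cong)
  have coeff: "fourier_coeff I L (trig_poly I N x) k = x k" if "k \<in> index_box I N" for k
    using fourier_coeff_trig_poly[OF I N, of k x'] index_box_mono[OF N(1), of I] that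
    by (auto simp: eq x'_def)
  have "(\<Sum>w\<in>grid I L. (semi (trig_poly I N x w))\<^sup>2)
      = Re (\<Sum>w\<in>grid I L. B (trig_poly I N x w) (trig_poly I N x w))"
    by (simp add: semi_square)
  also have "\<dots> = Re (of_nat L ^ card I * (\<Sum>k\<in>index_box I N. B (x k) (x k)))"
    by (simp add: inner_trig_poly[OF N] coeff)
  also have "\<dots> = real L ^ card I * (\<Sum>k\<in>index_box I N. (semi (x k))\<^sup>2)"
    by (simp add: semi_square Re_of_nat_power_mult)
  finally show ?thesis .
qed

lemma bessel:
  assumes I: "finite I" and N: "N \<le> L" "0 < L"
  shows "real L ^ card I * (\<Sum>k\<in>index_box I N. (semi (fourier_coeff I L y k))\<^sup>2)
    \<le> (\<Sum>w\<in>grid I L. (semi (y w))\<^sup>2)"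
proof -
  define u where "u = trig_poly I N (fourier_coeff I L y)"
  define a where "a = real L ^ card I * (\<Sum>k\<in>index_box I N. (semi (fourier_coeff I L y k))\<^sup>2)"
  have "(\<Sum>w\<in>grid I L. (semi (u w))\<^sup>2) = a"
    unfolding u_def a_def by (rule parseval[OF I N])
  moreover have "(\<Sum>w\<in>grid I L. Re (B (y w) (u w))) = a"
    using arg_cong[OF inner_trig_poly[OF N, where I = I and y = y and x = "fourier_coeff I L y"], of Re]
    by (simp add: u_def a_def semi_square Re_of_nat_power_mult)
  moreover have "0 \<le> (\<Sum>w\<in>grid I L. Re (B (y w - u w) (y w - u w)))"
    by (intro sum_nonneg nonneg)
  moreover have "Re (B (y w - u w) (y w - u w))
      = (semi (y w))\<^sup>2 - 2 * Re (B (y w) (u w)) + (semi (u w))\<^sup>2" for w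
    by (simp add: diff_left diff_right semi_square Re_commute[of "u w" "y w"])
  ultimately show ?thesis
    by (simp add: sum.distrib sum_subtractf a_def flip: sum_distrib_left)
qed

definition seq_norm :: "nat set \<Rightarrow> nat \<Rightarrow> ((nat \<Rightarrow> nat) \<Rightarrow> 'a) \<Rightarrow> real" where
  "seq_norm I N x = L2_set (\<lambda>k. semi (x k)) (index_box I N)"

lemma seq_norm_nonneg [simp]: "0 \<le> seq_norm I N x"
  by (simp add: seq_norm_def)

lemma seq_norm_square: "(seq_norm I N x)\<^sup>2 = (\<Sum>k\<in>index_box I N. Re (B (x k) (x k)))"
  by (simp add: seq_norm_def L2_set_def sum_nonneg semi_square nonneg)

lemma seq_norm_triangle: "seq_norm I N (\<lambda>k. x k + y k) \<le> seq_norm I N x + seq_norm I N y"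
  unfolding seq_norm_def
  by (rule order_trans[OF L2_set_mono L2_set_triangle_ineq]) (simp_all add: semi_triangle)

lemma seq_norm_scaleC: "seq_norm I N (\<lambda>k. c *\<^sub>C x k) = cmod c * seq_norm I N x"
  unfolding seq_norm_def by (simp add: semi_scaleC L2_set_right_distrib)

lemma seq_norm_zero: "seq_norm I N (\<lambda>k. 0) = 0"
  by (simp add: seq_norm_def L2_set_def)

lemma seq_norm_sum:
  "seq_norm I N (\<lambda>k. \<Sum>s\<in>S. c s *\<^sub>C x s k) \<le> (\<Sum>s\<in>S. cmod (c s) * seq_norm I N (x s))"
proof (induction S rule: infinite_finite_induct)
  case (insert s S)
  then show ?case
    using seq_norm_triangle[of I N "\<lambda>k. c s *\<^sub>C x s k" "\<lambda>k. \<Sum>s\<in>S. c s *\<^sub>C x s k"]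
    by (simp add: seq_norm_scaleC)
qed (simp_all add: seq_norm_zero)

end

text \<open>The operators on sequences in question are combinations of backward shifts with operator
  coefficients; replacing the shifts by scalars turns them into their symbol. Two properties, both
  stable under composition and linear combination, suffice for the norm bound: taking Fourier
  coefficients turns the symbol into the operator, and inputs that agree entry by entry from some
  \<open>L\<close> on have outputs with the same property, because each entry of the output involves finitely
  many entries of the input. The second one removes the aliasing of a grid of finite size \<open>L\<close>.\<close>

definition has_symbol :: "nat set \<Rightarrow> (((nat \<Rightarrow> nat) \<Rightarrow> 'a::chilbert_space) \<Rightarrow> (nat \<Rightarrow> nat) \<Rightarrow> 'a)
    \<Rightarrow> ((nat \<Rightarrow> complex) \<Rightarrow> 'a \<Rightarrow> 'a) \<Rightarrow> bool" where
  "has_symbol I \<Phi> \<sigma> \<longleftrightarrow>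
    (\<forall>L y. fourier_coeff I L (\<lambda>w. \<sigma> w (y w)) = \<Phi> (fourier_coeff I L y)) \<and>
    (\<forall>X x. (\<forall>k\<in>extensional I. \<forall>\<^sub>F L in sequentially. X L k = x k) \<longrightarrow>
      (\<forall>k\<in>extensional I. \<forall>\<^sub>F L in sequentially. \<Phi> (X L) k = \<Phi> x k))"

lemma has_symbol_id: "has_symbol I (\<lambda>x. x) (\<lambda>w v. v)"
  by (simp add: has_symbol_def)

lemma has_symbol_comp:
  assumes "has_symbol I \<Phi> \<sigma>" "has_symbol I \<Psi> \<tau>"
  shows "has_symbol I (\<lambda>x. \<Phi> (\<Psi> x)) (\<lambda>w v. \<sigma> w (\<tau> w v))"
proof -
  have "fourier_coeff I L (\<lambda>w. \<sigma> w (\<tau> w (y w))) = \<Phi> (\<Psi> (fourier_coeff I L y))" for L y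
    using assms unfolding has_symbol_def by metis
  then show ?thesis using assms unfolding has_symbol_def by simp
qed

lemma has_symbol_sum:
  fixes \<Phi> :: "'s \<Rightarrow> ((nat \<Rightarrow> nat) \<Rightarrow> 'a::chilbert_space) \<Rightarrow> (nat \<Rightarrow> nat) \<Rightarrow> 'a"
  assumes S: "finite S" and "\<And>s. s \<in> S \<Longrightarrow> has_symbol I (\<Phi> s) (\<sigma> s)"
  shows "has_symbol I (\<lambda>x k. \<Sum>s\<in>S. c s *\<^sub>C \<Phi> s x k) (\<lambda>w v. \<Sum>s\<in>S. c s *\<^sub>C \<sigma> s w v)"
  unfolding has_symbol_def
proof (intro conjI allI impI ballI ext)
  fix L and y :: "(nat \<Rightarrow> complex) \<Rightarrow> 'a" and k
  have "fourier_coeff I L (\<lambda>w. \<Sum>s\<in>S. c s *\<^sub>C \<sigma> s w (y w)) k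
      = (\<Sum>s\<in>S. c s *\<^sub>C fourier_coeff I L (\<lambda>w. \<sigma> s w (y w)) k)"
  proof -
    have "(\<Sum>w\<in>grid I L. mon I w k *\<^sub>C (\<Sum>s\<in>S. c s *\<^sub>C \<sigma> s w (y w)))
        = (\<Sum>s\<in>S. \<Sum>w\<in>grid I L. (mon I w k * c s) *\<^sub>C \<sigma> s w (y w))"
      by (simp only: scaleC_sum_right scaleC_scaleC) (rule sum.swap)
    then show ?thesis
      by (simp add: fourier_coeff_def scaleC_sum_right scaleC_scaleC mult_ac)
  qed
  also have "\<dots> = (\<Sum>s\<in>S. c s *\<^sub>C \<Phi> s (fourier_coeff I L y) k)"
    using assms(2) by (intro sum.cong refl) (simp add: has_symbol_def)
  finally show "fourier_coeff I L (\<lambda>w. \<Sum>s\<in>S. c s *\<^sub>C \<sigma> s w (y w)) k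
    = (\<Sum>s\<in>S. c s *\<^sub>C \<Phi> s (fourier_coeff I L y) k)" .
next
  fix X :: "nat \<Rightarrow> (nat \<Rightarrow> nat) \<Rightarrow> 'a" and x and k :: "nat \<Rightarrow> nat"
  assume X: "\<forall>k\<in>extensional I. \<forall>\<^sub>F L in sequentially. X L k = x k" and k: "k \<in> extensional I"
  have "\<forall>\<^sub>F L in sequentially. \<forall>s\<in>S. \<Phi> s (X L) k = \<Phi> s x k"
    using assms(2) X k unfolding has_symbol_def by (intro eventually_ball_finite S) blast
  then show "\<forall>\<^sub>F L in sequentially. (\<Sum>s\<in>S. c s *\<^sub>C \<Phi> s (X L) k) = (\<Sum>s\<in>S. c s *\<^sub>C \<Phi> s x k)"
    by eventually_elim simp
qed

lemma mon_shift:
  assumes "finite I" "i \<in> I"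
  shows "mon I w (k(i := k i + j)) = w i ^ j * mon I w k"
proof -
  have "mon I w (k(i := k i + j)) = w i ^ (k i + j) * (\<Prod>i'\<in>I - {i}. w i' ^ k i')"
    unfolding mon_def using assms by (subst prod.remove[of I i]) auto
  then show ?thesis
    unfolding mon_def using assms by (subst (2) prod.remove[of I i]) (auto simp: power_add)
qed

lemma has_symbol_shift:
  fixes \<theta> :: "'a::chilbert_space \<Rightarrow> 'a"
  assumes I: "finite I" "i \<in> I" and \<theta>: "clinear \<theta>"
  shows "has_symbol I (\<lambda>x k. \<theta> (x (k(i := k i + j)))) (\<lambda>w v. w i ^ j *\<^sub>C \<theta> v)"
  unfolding has_symbol_def
proof (intro conjI allI impI ballI ext)
  fix L and y :: "(nat \<Rightarrow> complex) \<Rightarrow> 'a" and k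
  show "fourier_coeff I L (\<lambda>w. w i ^ j *\<^sub>C \<theta> (y w)) k
      = \<theta> (fourier_coeff I L y (k(i := k i + j)))"
    using \<theta> by (simp add: fourier_coeff_def mon_shift[OF I] clinear_scaleC clinear_sum
        scaleC_scaleC mult_ac)
next
  fix X :: "nat \<Rightarrow> (nat \<Rightarrow> nat) \<Rightarrow> 'a" and x and k :: "nat \<Rightarrow> nat"
  assume X: "\<forall>k\<in>extensional I. \<forall>\<^sub>F L in sequentially. X L k = x k" and k: "k \<in> extensional I"
  have "k(i := k i + j) \<in> extensional I" using k I by (auto simp: extensional_def)
  then have "\<forall>\<^sub>F L in sequentially. X L (k(i := k i + j)) = x (k(i := k i + j))" using X by blast
  then show "\<forall>\<^sub>F L in sequentially. \<theta> (X L (k(i := k i + j))) = \<theta> (x (k(i := k i + j)))"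
    by eventually_elim simp
qed

text \<open>A truncated sequence is recovered from its Fourier transform on a sufficiently fine grid; on
  the grid the operator acts pointwise through its symbol, and Parseval's identity and Bessel's
  inequality compare the norms before and after.\<close>

lemma (in psd_form) seq_norm_le_symbol:
  assumes I: "finite I" and sym: "has_symbol I \<Phi> \<sigma>" and M: "0 \<le> M"
    and bound: "\<And>w v. (\<And>i. i \<in> I \<Longrightarrow> cmod (w i) = 1) \<Longrightarrow> semi (\<sigma> w v) \<le> M * semi v"
    and x: "\<And>k. k \<notin> index_box I N \<Longrightarrow> x k = 0"
  shows "seq_norm I N (\<Phi> x) \<le> M * seq_norm I N x"
proof -
  define u where "u = trig_poly I N x"
  have "\<forall>\<^sub>F L in sequentially. fourier_coeff I L u k = x k" if k: "k \<in> extensional I" for k :: "nat \<Rightarrow> nat"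
  proof -
    have "fourier_coeff I L u k = x k" if L: "L \<ge> Suc (N + (\<Sum>i\<in>I. k i))" for L
    proof -
      have "k i < L" if "i \<in> I" for i
        using member_le_sum[OF that _ I, of k] L by simp
      then have "k \<in> index_box I L" using k by (simp add: index_box_def PiE_iff)
      then show ?thesis unfolding u_def using L by (intro fourier_coeff_trig_poly I x) auto
    qed
    then show ?thesis by (rule eventually_sequentiallyI)
  qed
  then have "\<forall>\<^sub>F L in sequentially. \<Phi> (fourier_coeff I L u) k = \<Phi> x k" if "k \<in> index_box I N" for k
    using sym that unfolding has_symbol_def index_box_def by (simp add: PiE_iff)
  then have "\<forall>\<^sub>F L in sequentially. \<forall>k\<in>index_box I N. \<Phi> (fourier_coeff I L u) k = \<Phi> x k"
    by (intro eventually_ball_finite finite_index_box I) blast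
  then have "\<forall>\<^sub>F L in sequentially. Suc N \<le> L \<and> (\<forall>k\<in>index_box I N. \<Phi> (fourier_coeff I L u) k = \<Phi> x k)"
    by (intro eventually_conj eventually_ge_at_top)
  then obtain L where L: "L \<ge> Suc N" "\<forall>k\<in>index_box I N. \<Phi> (fourier_coeff I L u) k = \<Phi> x k"
    using eventually_happens'[OF trivial_limit_sequentially] by blast
  have N: "N \<le> L" "0 < L" using L(1) by auto
  have coeff: "fourier_coeff I L (\<lambda>w. \<sigma> w (u w)) k = \<Phi> x k" if "k \<in> index_box I N" for k
    using sym L(2) that unfolding has_symbol_def by simp
  have "real L ^ card I * (\<Sum>k\<in>index_box I N. (semi (\<Phi> x k))\<^sup>2)
      = real L ^ card I * (\<Sum>k\<in>index_box I N. (semi (fourier_coeff I L (\<lambda>w. \<sigma> w (u w)) k))\<^sup>2)"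
    by (simp add: coeff)
  also have "\<dots> \<le> (\<Sum>w\<in>grid I L. (semi (\<sigma> w (u w)))\<^sup>2)" by (rule bessel[OF I N])
  also have "\<dots> \<le> (\<Sum>w\<in>grid I L. M\<^sup>2 * (semi (u w))\<^sup>2)"
  proof (rule sum_mono)
    fix w assume "w \<in> grid I L"
    then have "semi (\<sigma> w (u w)) \<le> M * semi (u w)"
      using cmod_roots[OF N(2)] by (intro bound) (auto simp: grid_def PiE_iff)
    then show "(semi (\<sigma> w (u w)))\<^sup>2 \<le> M\<^sup>2 * (semi (u w))\<^sup>2"
      by (metis power_mono power_mult_distrib semi_nonneg)
  qed
  also have "\<dots> = real L ^ card I * (M\<^sup>2 * (\<Sum>k\<in>index_box I N. (semi (x k))\<^sup>2))"
    by (simp add: u_def parseval[OF I N] mult_ac flip: sum_distrib_left)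
  finally have "(\<Sum>k\<in>index_box I N. (semi (\<Phi> x k))\<^sup>2) \<le> M\<^sup>2 * (\<Sum>k\<in>index_box I N. (semi (x k))\<^sup>2)"
    using N by simp
  then have "(seq_norm I N (\<Phi> x))\<^sup>2 \<le> (M * seq_norm I N x)\<^sup>2"
    by (simp add: seq_norm_square power_mult_distrib semi_square)
  then show ?thesis by (rule power2_le_imp_le) (simp add: M)
qed

section \<open>Von Neumann's inequality in one variable for a semidefinite form\<close>

lemma sum_index_box_singleton: "(\<Sum>k\<in>index_box {i} N. F (k i)) = (\<Sum>t<N. F t)"
  by (rule sum.reindex_bij_witness[of _ "\<lambda>t. \<lambda>_\<in>{i}. t" "\<lambda>k. k i"])
    (auto simp: index_box_def PiE_iff extensional_def)

text \<open>Since \<open>semi (A v) \<le> r * semi v\<close> with \<open>r < 1\<close>, the deficiency \<open>B v v - B (A v) (A v)\<close>, summed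
  along the orbit of \<open>v\<close>, gives back \<open>B v v\<close>. The orbit map therefore carries \<open>A\<close> isometrically to
  the backward shift, whose polynomials have scalar symbols.\<close>

lemma (in psd_form) von_neumann_strict:
  assumes A: "clinear A" and r: "0 \<le> r" "r < 1" and Ar: "\<And>v. semi (A v) \<le> r * semi v"
    and K: "finite K"
    and M: "\<And>z. cmod z = 1 \<Longrightarrow> cmod (\<Sum>s\<in>K. a s * z ^ e s) \<le> M"
  shows "semi (\<Sum>s\<in>K. a s *\<^sub>C (A ^^ e s) v) \<le> M * semi v"
proof -
  define D where "D u v = B u v - B (A u) (A v)" for u v
  have Ar2: "Re (B (A v) (A v)) \<le> r\<^sup>2 * Re (B v v)" for v
    using Ar[of v] r by (simp add: semi_le_iff)
  interpret D: psd_form D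
  proof
    fix x
    have "r\<^sup>2 * Re (B x x) \<le> Re (B x x)"
      using r nonneg[of x] by (simp add: mult_left_le_one_le power_le_one)
    then show "0 \<le> Re (D x x)" using Ar2[of x] by (simp add: D_def)
  qed (simp_all add: D_def add_left scale_left clinear_add[OF A] clinear_scaleC[OF A]
      algebra_simps flip: herm)
  have M0: "0 \<le> M" using M[of 1] by (simp add: order_trans[OF norm_ge_zero])
  have Apow: "clinear (A ^^ j)" for j by (rule clinear_funpow[OF A])
  have tele: "(\<Sum>t<N. Re (D ((A ^^ t) u) ((A ^^ t) u))) = Re (B u u) - Re (B ((A ^^ N) u) ((A ^^ N) u))"
    for N u by (induction N) (simp_all add: D_def)
  define g where "g = (\<Sum>s\<in>K. a s *\<^sub>C (A ^^ e s) v)"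
  define d where "d = (\<Sum>s\<in>K. e s)"
  have main: "(1 - (r ^ N)\<^sup>2) * Re (B g g) \<le> M\<^sup>2 * Re (B v v)" for N
  proof -
    define x where "x k = (if k \<in> index_box {0} (N + d) then (A ^^ k 0) v else 0)" for k :: "nat \<Rightarrow> nat"
    define \<Phi> where "\<Phi> x k = (\<Sum>s\<in>K. a s *\<^sub>C x (k(0 := k 0 + e s)))"
      for x :: "(nat \<Rightarrow> nat) \<Rightarrow> 'a" and k :: "nat \<Rightarrow> nat"
    have sym: "has_symbol {0} \<Phi> (\<lambda>w u. \<Sum>s\<in>K. a s *\<^sub>C w 0 ^ e s *\<^sub>C u)"
      unfolding \<Phi>_def using has_symbol_shift[of "{0}" 0 "\<lambda>v. v"]
      by (intro has_symbol_sum K) (simp_all add: clinear_def)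
    have le: "D.seq_norm {0} (N + d) (\<Phi> x) \<le> M * D.seq_norm {0} (N + d) x"
    proof (rule D.seq_norm_le_symbol[OF _ sym M0])
      fix w :: "nat \<Rightarrow> complex" and u :: 'a assume w: "\<And>i. i \<in> {0} \<Longrightarrow> cmod (w i) = 1"
      have "(\<Sum>s\<in>K. a s *\<^sub>C w 0 ^ e s *\<^sub>C u) = (\<Sum>s\<in>K. a s * w 0 ^ e s) *\<^sub>C u"
        by (simp add: scaleC_scaleC scaleC_sum_left)
      then show "D.semi (\<Sum>s\<in>K. a s *\<^sub>C w 0 ^ e s *\<^sub>C u) \<le> M * D.semi u"
        using M[of "w 0"] w by (simp add: D.semi_scaleC mult_right_mono)
    qed (simp_all add: x_def)
    have \<Phi>x: "\<Phi> x k = (A ^^ k 0) g" if k: "k \<in> index_box {0} N" for k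
    proof -
      have "x (k(0 := k 0 + e s)) = (A ^^ k 0) ((A ^^ e s) v)" if s: "s \<in> K" for s
      proof -
        have "e s \<le> d" unfolding d_def using s K by (intro member_le_sum) auto
        then have "k(0 := k 0 + e s) \<in> index_box {0} (N + d)"
          using k by (auto simp: index_box_def PiE_iff extensional_def)
        then show ?thesis by (simp add: x_def funpow_add)
      qed
      then show ?thesis
        by (simp add: \<Phi>_def g_def clinear_sum[OF Apow] clinear_scaleC[OF Apow])
    qed
    have "(\<Sum>t<N. Re (D ((A ^^ t) g) ((A ^^ t) g))) = (\<Sum>k\<in>index_box {0} N. Re (D (\<Phi> x k) (\<Phi> x k)))"
      by (simp add: \<Phi>x sum_index_box_singleton[where F = "\<lambda>t. Re (D ((A ^^ t) g) ((A ^^ t) g))"])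
    also have "\<dots> \<le> (\<Sum>k\<in>index_box {0} (N + d). Re (D (\<Phi> x k) (\<Phi> x k)))"
      by (intro sum_mono2 finite_index_box index_box_mono D.nonneg) auto
    also have "\<dots> = (D.seq_norm {0} (N + d) (\<Phi> x))\<^sup>2" by (simp add: D.seq_norm_square)
    also have "\<dots> \<le> (M * D.seq_norm {0} (N + d) x)\<^sup>2" by (intro power_mono le) simp
    also have "\<dots> = M\<^sup>2 * (\<Sum>k\<in>index_box {0} (N + d). Re (D ((A ^^ k 0) v) ((A ^^ k 0) v)))"
      by (simp add: power_mult_distrib D.seq_norm_square x_def cong: sum.cong)
    also have "\<dots> = M\<^sup>2 * (Re (B v v) - Re (B ((A ^^ (N + d)) v) ((A ^^ (N + d)) v)))"
      by (simp only: sum_index_box_singleton[where F = "\<lambda>t. Re (D ((A ^^ t) v) ((A ^^ t) v))"] tele)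
    also have "\<dots> \<le> M\<^sup>2 * Re (B v v)"
      by (intro mult_left_mono) (simp_all add: nonneg)
    finally have "Re (B g g) - Re (B ((A ^^ N) g) ((A ^^ N) g)) \<le> M\<^sup>2 * Re (B v v)"
      by (simp only: tele)
    moreover have "Re (B ((A ^^ N) g) ((A ^^ N) g)) \<le> (r ^ N)\<^sup>2 * Re (B g g)"
    proof (induction N)
      case (Suc N)
      have "Re (B ((A ^^ Suc N) g) ((A ^^ Suc N) g)) \<le> r\<^sup>2 * Re (B ((A ^^ N) g) ((A ^^ N) g))"
        using Ar2 by simp
      also have "\<dots> \<le> r\<^sup>2 * ((r ^ N)\<^sup>2 * Re (B g g))" by (intro mult_left_mono Suc) simp
      finally show ?case by (simp add: power_mult_distrib mult_ac)
    qed simp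
    ultimately show ?thesis by (simp add: algebra_simps)
  qed
  have "(\<lambda>N. (1 - (r ^ N)\<^sup>2) * Re (B g g)) \<longlonglongrightarrow> (1 - 0\<^sup>2) * Re (B g g)"
    using r by (intro tendsto_intros LIMSEQ_power_zero) simp
  then have "(1 - 0\<^sup>2) * Re (B g g) \<le> M\<^sup>2 * Re (B v v)"
    by (rule LIMSEQ_le_const2) (use main in blast)
  then show ?thesis using M0 by (simp add: semi_le_iff flip: g_def)
qed

lemma scaled_funpow:
  assumes "clinear A" shows "((\<lambda>v. c *\<^sub>C A v) ^^ j) v = c ^ j *\<^sub>C (A ^^ j) v"
  by (induction j) (simp_all add: clinear_scaleC[OF assms] scaleC_scaleC mult.commute)

text \<open>The strict case for \<open>r A\<close>, as \<open>r\<close> tends to 1.\<close>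

lemma (in psd_form) von_neumann_one_variable:
  assumes A: "clinear A" and contr: "\<And>v. semi (A v) \<le> semi v" and K: "finite K"
    and M: "\<And>z. cmod z = 1 \<Longrightarrow> cmod (\<Sum>s\<in>K. a s * z ^ e s) \<le> M"
  shows "semi (\<Sum>s\<in>K. a s *\<^sub>C (A ^^ e s) v) \<le> M * semi v"
proof -
  define g where "g r = (\<Sum>s\<in>K. a s *\<^sub>C complex_of_real r ^ e s *\<^sub>C (A ^^ e s) v)" for r :: real
  define \<delta> where "\<delta> r = (\<Sum>s\<in>K. cmod (a s) * \<bar>1 - r ^ e s\<bar> * semi ((A ^^ e s) v))" for r :: real
  define \<rho> where "\<rho> n = real n / real (Suc n)" for n
  have "semi (g 1) \<le> M * semi v + \<delta> (\<rho> n)" for n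
  proof -
    have \<rho>: "0 \<le> \<rho> n" "\<rho> n < 1" by (simp_all add: \<rho>_def)
    have "semi (g (\<rho> n)) \<le> M * semi v"
      using von_neumann_strict[of "\<lambda>v. complex_of_real (\<rho> n) *\<^sub>C A v" "\<rho> n" K a e M v]
        A contr \<rho> K M
      by (simp add: g_def scaled_funpow[OF A] semi_scaleC mult_left_mono clinear_def
          scaleC_add_right scaleC_scaleC mult.commute)
    moreover have "semi (g 1 - g (\<rho> n)) \<le> \<delta> (\<rho> n)"
    proof -
      have "g 1 - g (\<rho> n)
          = (\<Sum>s\<in>K. (a s * complex_of_real (1 - \<rho> n ^ e s)) *\<^sub>C (A ^^ e s) v)"
        by (simp add: g_def scaleC_scaleC right_diff_distrib scaleC_diff_left flip: sum_subtractf)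
      then show ?thesis unfolding \<delta>_def
        by (simp only:) (rule order_trans[OF semi_sum],
            simp add: semi_scaleC norm_mult del: of_real_diff of_real_power)
    qed
    ultimately show ?thesis
      using semi_triangle[of "g (\<rho> n)" "g 1 - g (\<rho> n)"] by simp
  qed
  moreover have "(\<lambda>n. M * semi v + \<delta> (\<rho> n)) \<longlonglongrightarrow> M * semi v + \<delta> 1"
    unfolding \<delta>_def \<rho>_def by (intro tendsto_intros LIMSEQ_n_over_Suc_n)
  ultimately have "semi (g 1) \<le> M * semi v + \<delta> 1"
    by (intro LIMSEQ_le_const) auto
  then show ?thesis by (simp add: g_def \<delta>_def)
qed

section \<open>The exchange identity and its contractive realisation\<close>

locale exchange_pair = P: psd_form P + Q: psd_form Q
  for P Q :: "'a::chilbert_space \<Rightarrow> 'a \<Rightarrow> complex" +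
  fixes a b :: "'a \<Rightarrow> 'a" and c :: real
  assumes a: "clinear a" and b: "clinear b" and b_contr: "norm (b v) \<le> norm v"
    and P_bounded: "cmod (P u v) \<le> c * (norm u * norm v)"
    and Q_bounded: "cmod (Q u v) \<le> c * (norm u * norm v)"
    and exchange: "Q u v + P (a u) (a v) = P u v + Q (b u) (b v)"
begin

text \<open>The exchange identity says that \<open>(h, b h) \<mapsto> (a h, h)\<close> preserves the form \<open>P \<oplus> Q\<close>. An
  everywhere defined contraction \<open>(u, v) \<mapsto> (a z, z)\<close> that agrees with it up to \<open>\<epsilon>\<close> is obtained by
  letting \<open>z = C u + E v\<close> solve the regularised normal equation
  \<open>(P + b\<^sup>* Q b + \<epsilon>) z = P u + b\<^sup>* Q v\<close> of fitting \<open>(z, b z)\<close> to \<open>(u, v)\<close>. The summand \<open>\<epsilon>\<close> makes it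
  coercive; without it one would have to project onto the closure of the graph of \<open>b\<close> in the
  completion with respect to \<open>P \<oplus> Q\<close>.\<close>

lemma contractive_realisation:
  assumes \<epsilon>: "0 < \<epsilon>"
  obtains C E where "clinear C" "clinear E"
    and "\<And>u v. (P.semi (a (C u + E v)))\<^sup>2 + (Q.semi (C u + E v))\<^sup>2 \<le> (P.semi u)\<^sup>2 + (Q.semi v)\<^sup>2"
    and "\<And>h. (P.semi (a (h - (C h + E (b h)))))\<^sup>2 + (Q.semi (h - (C h + E (b h))))\<^sup>2
      \<le> \<epsilon> * (norm h)\<^sup>2"
proof -
  define M where "M u v = P u v + Q (b u) (b v) + complex_of_real \<epsilon> * cinner u v" for u v :: 'a
  interpret M: hermitian_form M
  proof
    fix x y show "M x y = cnj (M y x)"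
      unfolding M_def by (simp flip: P.herm Q.herm cinner_commute)
  qed (simp_all add: M_def P.add_left P.scale_left Q.add_left Q.scale_left clinear_add[OF b]
      clinear_scaleC[OF b] cinner.add_left cinner.scale_left algebra_simps)
  have M_self: "Re (M z z) = (P.semi (a z))\<^sup>2 + (Q.semi z)\<^sup>2 + \<epsilon> * (norm z)\<^sup>2"
    "Re (M z z) = (P.semi z)\<^sup>2 + (Q.semi (b z))\<^sup>2 + \<epsilon> * (norm z)\<^sup>2" for z
    using arg_cong[OF exchange[of z z], of Re]
    by (simp_all add: M_def P.semi_square Q.semi_square cinner_self)
  have coercive: "\<epsilon> * (norm z)\<^sup>2 \<le> Re (M z z)" for z by (simp add: M_self)
  have c0: "0 \<le> c * (norm u * norm v)" for u v :: 'a
    using P_bounded[of u v] norm_ge_zero order_trans by blast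
  have Qb: "cmod (Q u (b v)) \<le> \<bar>c\<bar> * (norm u * norm v)" for u v :: 'a
  proof -
    have "cmod (Q u (b v)) \<le> \<bar>c\<bar> * (norm u * norm (b v))"
      using Q_bounded[of u "b v"] mult_right_mono[OF abs_ge_self[of c], of "norm u * norm (b v)"]
      by simp
    also have "\<dots> \<le> \<bar>c\<bar> * (norm u * norm v)" by (intro mult_left_mono b_contr) auto
    finally show ?thesis .
  qed
  have Pc: "cmod (P u v) \<le> \<bar>c\<bar> * (norm u * norm v)" for u v :: 'a
    using P_bounded[of u v] mult_right_mono[OF abs_ge_self[of c], of "norm u * norm v"] by simp
  have bil: "bounded_bilinear (\<lambda>u v. Re (M u v))"
  proof (rule bounded_bilinear.intro)
    show "\<exists>K. \<forall>u v. norm (Re (M u v)) \<le> norm u * norm v * K"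
    proof (intro exI allI)
      fix u v
      have "cmod (M u v) \<le> cmod (P u v) + cmod (Q (b u) (b v)) + \<epsilon> * cmod (cinner u v)"
        unfolding M_def using norm_triangle_ineq[of "P u v + Q (b u) (b v)" "\<epsilon> * cinner u v"]
          norm_triangle_ineq[of "P u v" "Q (b u) (b v)"] \<epsilon> by (simp add: norm_mult)
      also have "\<dots> \<le> \<bar>c\<bar> * (norm u * norm v) + \<bar>c\<bar> * (norm u * norm v) + \<epsilon> * (norm u * norm v)"
        using \<epsilon> mult_left_mono[OF b_contr[of u] norm_ge_zero[of v]] by (intro add_mono Pc mult_left_mono cmod_cinner_le order_trans[OF Qb])
          (simp_all add: mult_ac)
      finally show "norm (Re (M u v)) \<le> norm u * norm v * (2 * \<bar>c\<bar> + \<epsilon>)"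
        using abs_Re_le_cmod[of "M u v"] by (simp add: algebra_simps)
    qed
  qed (simp_all add: M.add_left M.add_right M.scaleR_left M.scaleR_right)
  have "\<exists>z. \<forall>v. M z v = P u v + Q w (b v)" for u w :: 'a
  proof -
    define \<phi> where "\<phi> v = P u v + Q w (b v)" for v
    have i: "\<phi> (\<i> *\<^sub>C v) = - \<i> * \<phi> v" for v
      by (simp add: \<phi>_def P.scale_right clinear_scaleC[OF b] Q.scale_right algebra_simps)
    have "bounded_linear (\<lambda>v. Re (\<phi> v))"
    proof (rule bounded_linear_intro)
      fix v
      have "\<bar>Re (\<phi> v)\<bar> \<le> cmod (P u v) + cmod (Q w (b v))"
        unfolding \<phi>_def using abs_Re_le_cmod order_trans norm_triangle_ineq by blast
      also have "\<dots> \<le> \<bar>c\<bar> * (norm u * norm v) + \<bar>c\<bar> * (norm w * norm v)"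
        by (intro add_mono Pc Qb)
      finally show "norm (Re (\<phi> v)) \<le> norm v * (\<bar>c\<bar> * norm u + \<bar>c\<bar> * norm w)"
        by (simp add: algebra_simps)
    qed (simp_all add: \<phi>_def P.add_right Q.add_right clinear_add[OF b] P.scaleR_right
        scaleR_eq_scaleC clinear_scaleC[OF b] P.scale_right Q.scale_right algebra_simps)
    then obtain z where re: "\<And>v. Re (M z v) = Re (\<phi> v)"
      using coercive_representation[OF bil _ _ \<epsilon> coercive] M.Re_commute by metis
    have "Im (M z v) = Im (\<phi> v)" for v
      using re[of "\<i> *\<^sub>C v"] i[of v] by (simp add: M.scale_right)
    then have "\<forall>v. M z v = \<phi> v" using re by (simp add: complex_eq_iff)
    then show ?thesis unfolding \<phi>_def by blast
  qed
  then obtain sol where sol: "\<And>u w v. M (sol u w) v = P u v + Q w (b v)" by metis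
  have uniq: "z = z'" if "\<And>v. M z v = M z' v" for z z' :: 'a
  proof -
    have "M (z - z') (z - z') = 0" using that by (simp add: M.diff_left)
    then have "\<epsilon> * (norm (z - z'))\<^sup>2 \<le> 0" using coercive[of "z - z'"] by simp
    then show ?thesis using \<epsilon> by (simp add: mult_le_0_iff)
  qed
  have sol_add: "sol (u + u') (w + w') = sol u w + sol u' w'" for u u' w w' :: 'a
    by (rule uniq) (simp add: sol M.add_left P.add_left Q.add_left)
  have sol_scale: "sol (s *\<^sub>C u) (s *\<^sub>C w) = s *\<^sub>C sol u w" for s u w
    by (rule uniq) (simp add: sol M.scale_left P.scale_left Q.scale_left algebra_simps)
  define C where "C u = sol u 0" for u
  define E where "E w = sol 0 w" for w
  have CE: "C u + E w = sol u w" for u w :: 'a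
    using sol_add[of u 0 0 w] by (simp add: C_def E_def)
  have C: "clinear C" unfolding C_def
    using sol_add[of _ _ 0 0] sol_scale[of _ _ 0] by (intro clinearI) simp_all
  have E: "clinear E" unfolding E_def
    using sol_add[of 0 0] sol_scale[of _ 0] by (intro clinearI) simp_all
  have W1: "(P.semi (a (C u + E v)))\<^sup>2 + (Q.semi (C u + E v))\<^sup>2 \<le> (P.semi u)\<^sup>2 + (Q.semi v)\<^sup>2" for u v :: 'a
  proof -
    define z where "z = sol u v"
    define X where "X = (P.semi u)\<^sup>2 + (Q.semi v)\<^sup>2"
    define Y where "Y = (P.semi z)\<^sup>2 + (Q.semi (b z))\<^sup>2"
    have "Y \<le> Re (M z z)" using \<epsilon> by (simp add: Y_def M_self(2))
    also have "\<dots> = Re (P u z) + Re (Q v (b z))" by (simp add: z_def sol)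
    also have "\<dots> \<le> P.semi u * P.semi z + Q.semi v * Q.semi (b z)"
      by (intro add_mono P.cauchy_schwarz Q.cauchy_schwarz)
    also have "\<dots> \<le> (X + Y) / 2"
      using sum_squares_bound[of "P.semi u" "P.semi z"] sum_squares_bound[of "Q.semi v" "Q.semi (b z)"]
      by (simp add: X_def Y_def)
    finally have "Y \<le> X" by simp
    moreover have "(P.semi (a z))\<^sup>2 + (Q.semi z)\<^sup>2 = Y"
      using M_self[of z] by (simp add: Y_def)
    ultimately show ?thesis by (simp add: CE X_def z_def)
  qed
  have W2: "(P.semi (a (h - (C h + E (b h)))))\<^sup>2 + (Q.semi (h - (C h + E (b h))))\<^sup>2
      \<le> \<epsilon> * (norm h)\<^sup>2" for h :: 'a
  proof -
    define e where "e = h - sol h (b h)"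
    have "M e e = \<epsilon> * cinner h e"
      by (simp add: e_def M.diff_left sol) (simp add: M_def)
    then have "Re (M e e) \<le> \<epsilon> * (norm h * norm e)"
      using \<epsilon> norm_cauchy_schwarz[of h e] by (simp add: mult_left_mono flip: inner_eq_Re_cinner)
    also have "\<dots> \<le> \<epsilon> * ((norm h)\<^sup>2 + (norm e)\<^sup>2)"
    proof (rule mult_left_mono)
      show "norm h * norm e \<le> (norm h)\<^sup>2 + (norm e)\<^sup>2"
        using sum_squares_bound[of "norm h" "norm e"]
          mult_nonneg_nonneg[OF norm_ge_zero[of h] norm_ge_zero[of e]] by linarith
    qed (use \<epsilon> in simp)
    finally show ?thesis unfolding CE e_def[symmetric] by (simp add: M_self(1) algebra_simps)
  qed
  show thesis using that[OF C E W1 W2] .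
qed

end

text \<open>The pair \<open>(C, E)\<close> is a state space realisation of the power series
  \<open>\<Sum>j. w ^ j *\<^sub>C a ((E ^^ j) (C v))\<close>, which need not converge for \<open>cmod w = 1\<close>. Its Cesaro means are
  polynomials and are contractive on the whole unit circle: drive the system from state 0 with the
  constant input \<open>v\<close> for \<open>J\<close> steps, multiplying the state by \<open>w\<close> before each step. The total output
  energy is at most the total input energy, and the mean of the \<open>J\<close> outputs is the Cesaro mean.\<close>

locale contractive_system = P: psd_form P + Q: psd_form Q
  for P Q :: "'a::chilbert_space \<Rightarrow> 'a \<Rightarrow> complex" +
  fixes a C E :: "'a \<Rightarrow> 'a"
  assumes a: "clinear a" and C: "clinear C" and E: "clinear E"
    and dissipative:
      "(P.semi (a (C u + E v)))\<^sup>2 + (Q.semi (C u + E v))\<^sup>2 \<le> (P.semi u)\<^sup>2 + (Q.semi v)\<^sup>2"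
begin

text \<open>The coefficients of the transfer function, known as Markov parameters.\<close>

definition markov :: "nat \<Rightarrow> 'a \<Rightarrow> 'a" where "markov j v = a ((E ^^ j) (C v))"

definition cesaro :: "nat \<Rightarrow> complex \<Rightarrow> 'a \<Rightarrow> 'a" where
  "cesaro J w v = (\<Sum>j<J. complex_of_real ((real J - real j) / real J) *\<^sub>C w ^ j *\<^sub>C markov j v)"

lemma clinear_markov: "clinear (markov j)"
  unfolding markov_def by (rule clinear_comp[OF a clinear_comp[OF clinear_funpow[OF E] C]])

lemma clinear_cesaro: "clinear (cesaro J w)"
  unfolding cesaro_def
  by (intro clinearI)
    (simp_all add: clinear_add[OF clinear_markov] clinear_scaleC[OF clinear_markov] scaleC_scaleC
      scaleC_add_right scaleC_sum_right sum.distrib mult_ac)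

text \<open>Without input, the energy of all outputs comes from the initial state.\<close>

lemma free_dissipation:
  "(\<Sum>j<m. (P.semi (a ((E ^^ Suc j) v)))\<^sup>2) + (Q.semi ((E ^^ m) v))\<^sup>2 \<le> (Q.semi v)\<^sup>2"
proof (induction m)
  case (Suc m)
  then show ?case
    using dissipative[of 0 "(E ^^ m) v"] clinear_zero[OF C] by simp
qed simp

lemma semi_free_response: "P.semi (a ((E ^^ Suc j) v)) \<le> Q.semi v"
proof -
  have "(P.semi (a ((E ^^ Suc j) v)))\<^sup>2 \<le> (\<Sum>i<Suc j. (P.semi (a ((E ^^ Suc i) v)))\<^sup>2)"
    by (intro member_le_sum) auto
  also have "\<dots> \<le> (Q.semi v)\<^sup>2"
    using free_dissipation[where m = "Suc j" and v = v] by (smt (verit) zero_le_power2)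
  finally show ?thesis by (rule power2_le_imp_le) (rule Q.semi_nonneg)
qed

lemma semi_markov: "P.semi (markov j v) \<le> P.semi v"
proof -
  have "(P.semi (a (C v)))\<^sup>2 + (Q.semi (C v))\<^sup>2 \<le> (P.semi v)\<^sup>2"
    using dissipative[of v 0] by (simp add: clinear_zero[OF E])
  then have "P.semi (a (C v)) \<le> P.semi v" "Q.semi (C v) \<le> P.semi v"
    by (smt (verit) P.semi_nonneg power2_le_imp_le zero_le_power2)+
  then show ?thesis unfolding markov_def
    using semi_free_response[of "j - 1" "C v"] by (cases j) auto
qed

lemma semi_cesaro:
  assumes w: "cmod w = 1" and J: "0 < J"
  shows "P.semi (cesaro J w v) \<le> P.semi v"
proof -
  define s where "s t = (\<Sum>j<t. w ^ j *\<^sub>C (E ^^ j) (C v))" for t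
  have s_Suc: "s (Suc t) = C v + E (w *\<^sub>C s t)" for t
    by (simp add: s_def sum.lessThan_Suc_shift clinear_sum[OF E] clinear_scaleC[OF E] scaleC_sum_right
        scaleC_scaleC del: sum.lessThan_Suc)
  have energy: "(\<Sum>t<m. (P.semi (a (s (Suc t))))\<^sup>2) + (Q.semi (s m))\<^sup>2 \<le> real m * (P.semi v)\<^sup>2" for m
  proof (induction m)
    case (Suc m)
    then show ?case
      using dissipative[of v "w *\<^sub>C s m"] w
      by (simp add: Q.semi_scaleC algebra_simps flip: s_Suc)
  qed (simp add: s_def)
  have mean: "(\<Sum>t<m. s (Suc t)) = (\<Sum>j<m. complex_of_real (real m - real j) *\<^sub>C w ^ j *\<^sub>C (E ^^ j) (C v))"
    for m
  proof (induction m)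
    case (Suc m)
    have "(\<Sum>j<m. complex_of_real (real (Suc m) - real j) *\<^sub>C w ^ j *\<^sub>C (E ^^ j) (C v))
        = (\<Sum>j<m. complex_of_real (real m - real j) *\<^sub>C w ^ j *\<^sub>C (E ^^ j) (C v)) + s m"
      by (simp add: s_def scaleC_add_left scaleC_diff_left algebra_simps flip: sum.distrib)
    then show ?case using Suc by (simp add: s_def)
  qed simp
  have "cesaro J w v = complex_of_real (1 / real J) *\<^sub>C a (\<Sum>t<J. s (Suc t))"
    by (simp add: mean cesaro_def markov_def clinear_sum[OF a] clinear_scaleC[OF a]
        scaleC_sum_right scaleC_scaleC)
  then have "P.semi (cesaro J w v) = P.semi (\<Sum>t<J. a (s (Suc t))) / real J"
    by (simp add: P.semi_scaleC clinear_sum[OF a] norm_divide)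
  also have "\<dots> \<le> (\<Sum>t<J. P.semi (a (s (Suc t)))) / real J"
    by (intro divide_right_mono P.semi_sum) simp
  also have "\<dots> \<le> P.semi v"
  proof -
    have "(\<Sum>t<J. P.semi (a (s (Suc t))))\<^sup>2 \<le> (\<Sum>t<J. (P.semi (a (s (Suc t))))\<^sup>2) * real J"
      using sum_squared_le_sum_of_squares[of "\<lambda>t. P.semi (a (s (Suc t)))" "{..<J}"] by simp
    also have "\<dots> \<le> (real J * (P.semi v)\<^sup>2) * real J"
      using energy[of J] by (intro mult_right_mono) (smt (verit) zero_le_power2, simp)
    finally have "(\<Sum>t<J. P.semi (a (s (Suc t))))\<^sup>2 \<le> (real J * P.semi v)\<^sup>2"
      by (simp add: power2_eq_square mult_ac)
    then have "(\<Sum>t<J. P.semi (a (s (Suc t)))) \<le> real J * P.semi v"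
      by (rule power2_le_imp_le) simp
    then show ?thesis using J by (simp add: field_simps)
  qed
  finally show ?thesis .
qed

end

section \<open>Szego forms and their energy identity\<close>

text \<open>The form of the inverse Szego operator of a tuple whose adjoints are the members of the list
  (\<open>szego_inverse_form\<close> below). Its recursion adds one variable at a time, the way in which all of its
  properties are proved.\<close>

primrec szego_form :: "('a::chilbert_space \<Rightarrow> 'a) list \<Rightarrow> 'a \<Rightarrow> 'a \<Rightarrow> complex" where
  "szego_form [] u v = cinner u v"
| "szego_form (A # As) u v = szego_form As u v - szego_form As (A u) (A v)"

lemma hermitian_szego_form:
  assumes "\<And>A. A \<in> set As \<Longrightarrow> clinear A" shows "hermitian_form (szego_form As)"
  using assms
proof (induction As)
  case Nil
  show ?case using cinner.hermitian_form_axioms by (simp add: hermitian_form_def)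
next
  case (Cons A As)
  interpret F: hermitian_form "szego_form As" using Cons by simp
  have A: "clinear A" using Cons by simp
  show ?case
  proof
    fix x y show "szego_form (A # As) x y = cnj (szego_form (A # As) y x)"
      by (simp flip: F.herm)
  qed (simp_all add: F.add_left F.scale_left clinear_add[OF A] clinear_scaleC[OF A] algebra_simps)
qed

lemma cmod_szego_form_le:
  assumes "\<And>A v. A \<in> set As \<Longrightarrow> norm (A v) \<le> norm v"
  shows "cmod (szego_form As u v) \<le> 2 ^ length As * (norm u * norm v)"
  using assms
proof (induction As arbitrary: u v)
  case Nil
  show ?case by (simp add: cmod_cinner_le)
next
  case (Cons A As)
  have "cmod (szego_form (A # As) u v)
      \<le> cmod (szego_form As u v) + cmod (szego_form As (A u) (A v))"
    by (simp add: norm_triangle_ineq4)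
  also have "\<dots> \<le> 2 ^ length As * (norm u * norm v) + 2 ^ length As * (norm (A u) * norm (A v))"
    using Cons by (intro add_mono) auto
  also have "\<dots> \<le> 2 ^ length As * (norm u * norm v) + 2 ^ length As * (norm u * norm v)"
    using Cons.prems by (intro add_left_mono mult_left_mono mult_mono) auto
  finally show ?case by (simp add: mult_ac)
qed

text \<open>The telescoping arguments below need the variable in question at the head of the list, and the
  Szego inverses list the variables in their original order; commutativity reconciles them.\<close>

lemma szego_form_move:
  assumes "\<And>A' v. A' \<in> set As \<Longrightarrow> A (A' v) = A' (A v)"
  shows "szego_form (As @ A # Bs) u v = szego_form (A # As @ Bs) u v"
  using assms by (induction As arbitrary: u v) auto

lemma szego_form_perm:
  assumes "mset As = mset Bs" and "\<And>A A' v. A \<in> set As \<Longrightarrow> A' \<in> set As \<Longrightarrow> A (A' v) = A' (A v)"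
  shows "szego_form As u v = szego_form Bs u v"
  using assms
proof (induction As arbitrary: Bs u v)
  case (Cons A As)
  obtain xs ys where Bs: "Bs = xs @ A # ys"
    using Cons.prems(1) by (metis list.set_intros(1) set_mset_mset split_list)
  have eq: "mset As = mset (xs @ ys)" using Cons.prems(1) by (simp add: Bs)
  then have "szego_form As u v = szego_form (xs @ ys) u v" for u v
    using Cons.prems(2) by (intro Cons.IH) auto
  moreover have "set xs \<subseteq> set As" using arg_cong[OF eq, of set_mset] by auto
  then have "szego_form Bs u v = szego_form (A # xs @ ys) u v"
    unfolding Bs using Cons.prems(2) by (intro szego_form_move) auto
  ultimately show ?case by simp
qed simp

primrec list_power :: "(nat \<Rightarrow> 'a \<Rightarrow> 'a) \<Rightarrow> nat list \<Rightarrow> (nat \<Rightarrow> nat) \<Rightarrow> 'a \<Rightarrow> 'a" where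
  "list_power B [] k v = v"
| "list_power B (i # js) k v = (B i ^^ k i) (list_power B js k v)"

lemma list_power_cong: "(\<And>i. i \<in> set js \<Longrightarrow> k i = k' i) \<Longrightarrow> list_power B js k v = list_power B js k' v"
  by (induction js) auto

lemma funpow_commute:
  assumes "\<And>v. A (A' v) = A' (A v)" shows "(A ^^ j) (A' v) = A' ((A ^^ j) v)"
  by (induction j) (simp_all add: assms)

lemma list_power_commute:
  assumes "\<And>i v. i \<in> set js \<Longrightarrow> A (B i v) = B i (A v)"
  shows "list_power B js k (A v) = A (list_power B js k v)"
  using assms
proof (induction js)
  case (Cons i js)
  have "(B i ^^ k i) (A u) = A ((B i ^^ k i) u)" for u
    using Cons.prems by (intro funpow_commute) auto
  then show ?case using Cons by simp
qed simp

lemma list_power_shift: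
  assumes "distinct js" "i \<in> set js"
    and "\<And>i' v. i' \<in> set js \<Longrightarrow> B i (B i' v) = B i' (B i v)"
  shows "list_power B js (k(i := k i + j)) v = (B i ^^ j) (list_power B js k v)"
  using assms
proof (induction js)
  case (Cons i' js)
  show ?case
  proof (cases "i' = i")
    case True
    then have "list_power B js (k(i := k i + j)) v = list_power B js k v"
      using Cons.prems(1) by (intro list_power_cong) auto
    then have "list_power B (i # js) (k(i := k i + j)) v = (B i ^^ (j + k i)) (list_power B js k v)"
      by (simp only: list_power.simps fun_upd_same add.commute[of "k i"])
    then show ?thesis unfolding True by (simp only: funpow_add comp_apply list_power.simps)
  next
    case False
    have "(B i' ^^ m) ((B i ^^ j) u) = (B i ^^ j) ((B i' ^^ m) u)" for m u
      using Cons.prems(3)[of i'] by (intro funpow_commute funpow_commute[symmetric]) auto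
    then show ?thesis using Cons False by simp
  qed
qed simp

lemma norm_funpow_le:
  fixes A :: "'a::real_normed_vector \<Rightarrow> 'a"
  assumes "\<And>v. norm (A v) \<le> norm v" shows "norm ((A ^^ j) v) \<le> norm v"
proof (induction j)
  case (Suc j)
  show ?case using order_trans[OF assms[of "(A ^^ j) v"] Suc] by simp
qed simp

lemma norm_list_power_le:
  assumes "\<And>i v. i \<in> set js \<Longrightarrow> norm (B i v) \<le> norm v" shows "norm (list_power B js k v) \<le> norm v"
  using assms
proof (induction js)
  case (Cons i js)
  then show ?case by (auto intro: order_trans[OF norm_funpow_le])
qed simp

lemma clinear_list_power:
  assumes "\<And>i. i \<in> set js \<Longrightarrow> clinear (B i)" shows "clinear (list_power B js k)"
  using assms
proof (induction js)
  case (Cons i js)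
  then have "clinear (B i ^^ k i)" "clinear (list_power B js k)" by (simp_all add: clinear_funpow)
  then show ?case by (simp add: clinear_def)
qed (simp add: clinear_def)

lemma sum_index_box_insert:
  assumes "i \<notin> S"
  shows "(\<Sum>k\<in>index_box (insert i S) N. F k) = (\<Sum>j<N. \<Sum>k\<in>index_box S N. F (k(i := j)))"
proof -
  have "(\<Sum>k\<in>index_box (insert i S) N. F k) = (\<Sum>(j, k)\<in>{..<N} \<times> index_box S N. F (k(i := j)))"
    unfolding index_box_def PiE_insert_eq
    by (subst sum.reindex[OF inj_combinator[OF assms]]) (auto intro!: sum.cong)
  then show ?thesis by (simp add: sum.cartesian_product)
qed

text \<open>Summing the Szego form over the orbit telescopes one variable after the other; what remains
  is the Szego form of the \<open>N\<close>-th powers. The second list takes up the variables that the induction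
  has already split off: the difference in the variable \<open>i\<close> stays in the form until the sum over \<open>k i\<close>
  is carried out.\<close>

lemma szego_energy:
  assumes "distinct js'" and "set js' \<subseteq> X" "set js \<subseteq> X"
    and comm: "\<And>i j v. i \<in> X \<Longrightarrow> j \<in> X \<Longrightarrow> B i (B j v) = B j (B i v)"
  shows "(\<Sum>k\<in>index_box (set js') N.
      szego_form (map B js' @ map B js) (list_power B js' k h) (list_power B js' k h))
    = szego_form (map (\<lambda>i. B i ^^ N) js' @ map B js) h h"
  using assms(1-3)
proof (induction js' arbitrary: js h)
  case Nil
  then show ?case by (simp add: index_box_def)
next
  case (Cons i js')
  have i: "i \<in> X" "i \<notin> set js'" and sub: "set js' \<subseteq> X" using Cons.prems by auto
  let ?pow = "map (\<lambda>i. B i ^^ N) js'"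
  have move1: "szego_form (B i # map B js' @ map B js) u v
      = szego_form (map B js' @ map B (i # js)) u v" for u v
  proof -
    have "szego_form (map B js' @ B i # map B js) u v = szego_form (B i # map B js' @ map B js) u v"
      using comm i sub by (intro szego_form_move) auto
    then show ?thesis by simp
  qed
  have comm_pow: "B i ((B i' ^^ N) v) = (B i' ^^ N) (B i v)" if "i' \<in> set js'" for i' v
    using that i sub by (intro funpow_commute[symmetric]) (auto intro: comm)
  have move2: "szego_form (?pow @ map B (i # js)) u v
      = szego_form (?pow @ map B js) u v - szego_form (?pow @ map B js) (B i u) (B i v)" for u v
  proof -
    have "szego_form (?pow @ B i # map B js) u v = szego_form (B i # ?pow @ map B js) u v"
      using comm_pow by (intro szego_form_move) auto
    then show ?thesis by simp
  qed
  have lp: "list_power B (i # js') (k(i := j)) h = list_power B js' k ((B i ^^ j) h)" for k j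
  proof -
    have "list_power B js' (k(i := j)) h = list_power B js' k h"
      using i by (intro list_power_cong) auto
    moreover have "list_power B js' k ((B i ^^ j) h) = (B i ^^ j) (list_power B js' k h)"
      using i sub by (intro list_power_commute funpow_commute) (auto intro: comm)
    ultimately show ?thesis by simp
  qed
  have IH: "(\<Sum>k\<in>index_box (set js') N.
      szego_form (map B js' @ map B (i # js)) (list_power B js' k u) (list_power B js' k u))
    = szego_form (?pow @ map B (i # js)) u u" for u
    using Cons.prems i by (intro Cons.IH) auto
  define \<sigma> where "\<sigma> u = szego_form (?pow @ map B js) u u" for u
  have "(\<Sum>k\<in>index_box (set (i # js')) N.
      szego_form (map B (i # js') @ map B js) (list_power B (i # js') k h) (list_power B (i # js') k h))
    = (\<Sum>j<N. \<Sum>k\<in>index_box (set js') N. szego_form (map B js' @ map B (i # js))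
        (list_power B js' k ((B i ^^ j) h)) (list_power B js' k ((B i ^^ j) h)))"
    by (simp only: list.set sum_index_box_insert[OF i(2)] lp list.map append_Cons move1)
  also have "\<dots> = (\<Sum>j<N. \<sigma> ((B i ^^ j) h) - \<sigma> ((B i ^^ Suc j) h))"
    by (simp only: IH move2) (simp add: \<sigma>_def)
  also have "\<dots> = \<sigma> h - \<sigma> ((B i ^^ N) h)"
    using sum_lessThan_telescope'[of "\<lambda>j. \<sigma> ((B i ^^ j) h)" N] by simp
  finally show ?case by (simp add: \<sigma>_def)
qed

lemma szego_form_powers_tendsto:
  assumes "\<And>i v. i \<in> set js' \<Longrightarrow> norm (B i v) \<le> norm v"
    and "\<And>i v. i \<in> set js' \<Longrightarrow> (\<lambda>r. norm ((B i ^^ r) v)) \<longlonglongrightarrow> 0"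
  shows "(\<lambda>N. szego_form (map (\<lambda>i. B i ^^ N) js') h h) \<longlonglongrightarrow> cinner h h"
  using assms
proof (induction js')
  case (Cons i js')
  let ?pow = "\<lambda>N. map (\<lambda>i. B i ^^ N) js'"
  have "(\<lambda>N. szego_form (?pow N) ((B i ^^ N) h) ((B i ^^ N) h)) \<longlonglongrightarrow> 0"
  proof (rule Lim_null_comparison)
    show "\<forall>\<^sub>F N in sequentially. norm (szego_form (?pow N) ((B i ^^ N) h) ((B i ^^ N) h))
        \<le> 2 ^ length js' * (norm ((B i ^^ N) h) * norm ((B i ^^ N) h))"
    proof (intro always_eventually allI)
      fix N
      show "norm (szego_form (?pow N) ((B i ^^ N) h) ((B i ^^ N) h))
        \<le> 2 ^ length js' * (norm ((B i ^^ N) h) * norm ((B i ^^ N) h))"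
      proof -
        have "norm (A v) \<le> norm v" if "A \<in> set (?pow N)" for A v
          using that Cons.prems(1) by (auto intro: norm_funpow_le)
        then show ?thesis
          using cmod_szego_form_le[of "?pow N" "(B i ^^ N) h" "(B i ^^ N) h"] by simp
      qed
    qed
    have "(\<lambda>N. norm ((B i ^^ N) h)) \<longlonglongrightarrow> 0" using Cons.prems(2) by simp
    then have "(\<lambda>N. 2 ^ length js' * (norm ((B i ^^ N) h) * norm ((B i ^^ N) h)))
        \<longlonglongrightarrow> 2 ^ length js' * (0 * 0)"
      by (intro tendsto_intros)
    then show "(\<lambda>N. 2 ^ length js' * (norm ((B i ^^ N) h) * norm ((B i ^^ N) h))) \<longlonglongrightarrow> 0"
      by simp
  qed
  from tendsto_diff[OF Cons.IH this] Cons.prems show ?case by simp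
qed simp

section \<open>The shift model\<close>

locale szego_pair =
  fixes B :: "nat \<Rightarrow> 'a::chilbert_space \<Rightarrow> 'a" and p q :: nat and js :: "nat list"
  assumes distinct: "distinct (p # q # js)"
    and lin: "i \<in> set (p # q # js) \<Longrightarrow> clinear (B i)"
    and contr: "i \<in> set (p # q # js) \<Longrightarrow> norm (B i v) \<le> norm v"
    and comm: "i \<in> set (p # q # js) \<Longrightarrow> j \<in> set (p # q # js) \<Longrightarrow> B i (B j v) = B j (B i v)"
    and pos_p: "0 \<le> Re (szego_form (map B (q # js)) h h)"
    and pos_q: "0 \<le> Re (szego_form (map B (p # js)) h h)"
    and pure: "i \<in> set (q # js) \<Longrightarrow> (\<lambda>r. norm ((B i ^^ r) h)) \<longlonglongrightarrow> 0"
begin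

definition P where "P = szego_form (map B (q # js))"
definition Q where "Q = szego_form (map B (p # js))"
definition I where "I = set (q # js)"

lemma finite_I [simp]: "finite I" and q_I [simp]: "q \<in> I" and p_I: "p \<notin> I"
  using distinct by (auto simp: I_def)

sublocale exchange_pair P Q "B p" "B q" "2 ^ Suc (length js)"
proof -
  have "hermitian_form P" "hermitian_form Q"
    unfolding P_def Q_def by (rule hermitian_szego_form; use lin in auto)+
  moreover have "cmod (szego_form (map B (i # js)) u v) \<le> 2 ^ Suc (length js) * (norm u * norm v)"
    if "i \<in> {p, q}" for i u v
    using cmod_szego_form_le[of "map B (i # js)" u v] that contr by force
  ultimately show "exchange_pair P Q (B p) (B q) (2 ^ Suc (length js))"
    using pos_p pos_q lin contr comm[of p q]
    by (intro exchange_pair.intro psd_form.intro psd_form_axioms.intro exchange_pair_axioms.intro)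
      (auto simp: P_def Q_def)
qed

definition mpow :: "(nat \<Rightarrow> nat) \<Rightarrow> 'a \<Rightarrow> 'a" where "mpow k = list_power B (q # js) k"

text \<open>The truncated orbit map. It plays the role of the canonical isometry from the space to its
  dilation space.\<close>

definition orbit :: "nat \<Rightarrow> 'a \<Rightarrow> (nat \<Rightarrow> nat) \<Rightarrow> 'a" where
  "orbit N h k = (if k \<in> index_box I N then mpow k h else 0)"

lemma mpow_shift: "i \<in> I \<Longrightarrow> mpow (k(i := k i + j)) h = (B i ^^ j) (mpow k h)"
  unfolding I_def mpow_def using distinct comm by (intro list_power_shift) auto

lemma mpow_commute: "i \<in> set (p # q # js) \<Longrightarrow> mpow k (B i h) = B i (mpow k h)"
  unfolding mpow_def using comm by (intro list_power_commute) auto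

lemma norm_mpow_le: "norm (mpow k h) \<le> norm h"
  unfolding mpow_def using contr by (intro norm_list_power_le) auto

lemma clinear_mpow: "clinear (mpow k)"
  unfolding mpow_def using lin by (intro clinear_list_power) auto

lemma orbit_outside: "k \<notin> index_box I N \<Longrightarrow> orbit N h k = 0"
  by (simp add: orbit_def)

definition energy :: "nat \<Rightarrow> 'a \<Rightarrow> real" where
  "energy N h = (\<Sum>k\<in>index_box I N. (P.semi (mpow k h))\<^sup>2)"

lemma seq_norm_orbit: "(P.seq_norm I N (orbit N h))\<^sup>2 = energy N h"
  unfolding P.seq_norm_square energy_def P.semi_square by (simp add: orbit_def)

lemma energy_mono: "N \<le> N' \<Longrightarrow> energy N h \<le> energy N' h"
  unfolding energy_def by (intro sum_mono2 finite_index_box index_box_mono) auto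

text \<open>By purity, the Szego form of the \<open>N\<close>-th powers tends to the inner product.\<close>

lemma energy_tendsto: "(\<lambda>N. energy N h) \<longlonglongrightarrow> (norm h)\<^sup>2"
proof -
  have "energy N h = Re (szego_form (map (\<lambda>i. B i ^^ N) (q # js)) h h)" for N
  proof -
    have "(\<Sum>k\<in>index_box I N. P (mpow k h) (mpow k h))
        = szego_form (map (\<lambda>i. B i ^^ N) (q # js)) h h"
    proof -
      have "(\<Sum>k\<in>index_box (set (q # js)) N. szego_form (map B (q # js) @ map B [])
            (list_power B (q # js) k h) (list_power B (q # js) k h))
          = szego_form (map (\<lambda>i. B i ^^ N) (q # js) @ map B []) h h"
        using distinct comm by (intro szego_energy[where X = "set (p # q # js)"]) auto
      then show ?thesis by (simp only: P_def I_def mpow_def list.map append_Nil2)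
    qed
    then show ?thesis by (simp only: energy_def P.semi_square flip: Re_sum)
  qed
  moreover have "(\<lambda>N. szego_form (map (\<lambda>i. B i ^^ N) (q # js)) h h) \<longlonglongrightarrow> cinner h h"
    using contr pure by (intro szego_form_powers_tendsto) auto
  ultimately have "(\<lambda>N. energy N h) \<longlonglongrightarrow> Re (cinner h h)"
    by (simp only: tendsto_Re)
  then show ?thesis by (simp add: cinner_self)
qed

lemma energy_le: "energy N h \<le> (norm h)\<^sup>2"
  using incseq_le[OF _ energy_tendsto] energy_mono by (simp add: incseq_def)

lemma seq_norm_orbit_le: "P.seq_norm I N (orbit N h) \<le> norm h"
  by (rule power2_le_imp_le) (simp_all add: seq_norm_orbit energy_le)

lemma seq_norm_orbit_tendsto: "(\<lambda>N. P.seq_norm I N (orbit N h)) \<longlonglongrightarrow> norm h"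
proof -
  have "P.seq_norm I N (orbit N h) = sqrt (energy N h)" for N
    using seq_norm_orbit[of N h] by (simp add: real_sqrt_unique)
  then show ?thesis using tendsto_real_sqrt[OF energy_tendsto[of h]] by simp
qed

lemma P_semi_le_norm: "P.semi v \<le> norm v"
proof -
  define k :: "nat \<Rightarrow> nat" where "k = (\<lambda>i\<in>I. 0)"
  have k: "k \<in> index_box I 1" by (simp add: k_def index_box_def)
  have "list_power B ls k v = v" if "set ls \<subseteq> I" for ls
    using that by (induction ls) (auto simp: k_def)
  then have "mpow k v = v" by (simp only: I_def mpow_def)
  then have "(P.semi v)\<^sup>2 \<le> energy 1 v"
    unfolding energy_def using k
    by (metis (mono_tags, lifting) finite_index_box finite_I member_le_sum zero_le_power2)
  also have "\<dots> \<le> (norm v)\<^sup>2" by (rule energy_le)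
  finally show ?thesis by (rule power2_le_imp_le) simp
qed

definition shift :: "nat \<Rightarrow> ((nat \<Rightarrow> nat) \<Rightarrow> 'a) \<Rightarrow> (nat \<Rightarrow> nat) \<Rightarrow> 'a" where
  "shift i x k = x (k(i := k i + 1))"

text \<open>Truncation to the box of size \<open>N\<close> spoils the intertwining only on the face \<open>k i = N - 1\<close>,
  whose energy is at most the increment of the energy from \<open>N\<close> to \<open>N + 1\<close>.\<close>

lemma shift_intertwines:
  assumes i: "i \<in> I"
  shows "(\<lambda>N. P.seq_norm I N (\<lambda>k. shift i (orbit N h) k - orbit N (B i h) k)) \<longlonglongrightarrow> 0"
proof -
  define d where "d N = (\<lambda>k. shift i (orbit N h) k - orbit N (B i h) k)" for N
  define next_index where "next_index k = k(i := k i + 1)" for k :: "nat \<Rightarrow> nat"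
  have next_power: "mpow (next_index k) h = mpow k (B i h)" for k
    using mpow_shift[OF i, of k 1 h] mpow_commute[of i k h] i
    by (simp add: next_index_def I_def)
  have inj: "inj next_index"
  proof (rule injI)
    fix k l assume eq: "next_index k = next_index l"
    show "k = l"
    proof
      fix x show "k x = l x"
        using fun_cong[OF eq, of x] by (cases "x = i") (auto simp: next_index_def)
    qed
  qed
  have "(P.seq_norm I N (d N))\<^sup>2 \<le> energy (Suc N) h - energy N h" for N
  proof -
    define face where "face = {k \<in> index_box I N. next_index k \<notin> index_box I N}"
    have fin: "finite face" unfolding face_def by (simp add: finite_index_box)
    have in_next: "next_index k \<in> index_box I (Suc N)" if "k \<in> index_box I N" for k
      using that i by (auto simp: next_index_def index_box_def PiE_iff extensional_def less_Suc_eq)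
    have d_eq: "P.semi (d N k) = (if k \<in> face then P.semi (mpow (next_index k) h) else 0)"
      if "k \<in> index_box I N" for k
    proof -
      have "d N k = orbit N h (next_index k) - mpow k (B i h)"
        using that by (simp add: d_def shift_def orbit_def next_index_def)
      then show ?thesis
        using that by (auto simp: orbit_def face_def next_power P.semi_minus)
    qed
    have "(P.seq_norm I N (d N))\<^sup>2 = (\<Sum>k\<in>index_box I N. (P.semi (d N k))\<^sup>2)"
      by (simp add: P.seq_norm_square P.semi_square)
    also have "\<dots> = (\<Sum>k\<in>index_box I N. if k \<in> face then (P.semi (mpow (next_index k) h))\<^sup>2 else 0)"
      by (intro sum.cong refl) (simp add: d_eq)
    also have "\<dots> = (\<Sum>k\<in>face. (P.semi (mpow (next_index k) h))\<^sup>2)"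
      by (subst sum.inter_restrict[symmetric])
        (auto simp: finite_index_box face_def intro!: sum.cong)
    also have "\<dots> = (\<Sum>k\<in>next_index ` face. (P.semi (mpow k h))\<^sup>2)"
      by (subst sum.reindex) (auto intro: inj_on_subset[OF inj])
    also have "\<dots> \<le> (\<Sum>k\<in>index_box I (Suc N) - index_box I N. (P.semi (mpow k h))\<^sup>2)"
      using in_next by (intro sum_mono2) (auto simp: face_def finite_index_box)
    also have "\<dots> = energy (Suc N) h - energy N h"
      unfolding energy_def by (intro sum_diff finite_index_box index_box_mono) auto
    finally show ?thesis .
  qed
  then have le: "P.seq_norm I N (d N) \<le> sqrt (energy (Suc N) h - energy N h)" for N
    by (simp add: real_le_rsqrt)
  have "(\<lambda>N. sqrt (energy (Suc N) h - energy N h)) \<longlonglongrightarrow> sqrt ((norm h)\<^sup>2 - (norm h)\<^sup>2)"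
    by (intro tendsto_real_sqrt tendsto_diff energy_tendsto LIMSEQ_Suc)
  then have "(\<lambda>N. sqrt (energy (Suc N) h - energy N h)) \<longlonglongrightarrow> 0" by simp
  then have "(\<lambda>N. P.seq_norm I N (d N)) \<longlonglongrightarrow> 0"
    by (rule Lim_null_comparison[rotated]) (simp add: le)
  then show ?thesis by (simp only: d_def)
qed

text \<open>The exchange identity gives \<open>Q y y \<le> P y y + Q (b y) (b y)\<close> for \<open>b = B q\<close>. Iterated along the pure
  operator \<open>b\<close>, it bounds \<open>Q\<close> by the energy in the direction \<open>q\<close>.\<close>

lemma Q_energy: "(\<Sum>k\<in>index_box (set js) N. (Q.semi (list_power B js k y))\<^sup>2) \<le> (norm y)\<^sup>2"
proof -
  let ?z = "\<lambda>k. list_power B js k y"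
  have q_js: "q \<notin> set js" using distinct by simp
  have step: "(Q.semi z)\<^sup>2 \<le> (P.semi z)\<^sup>2 + (Q.semi (B q z))\<^sup>2" for z
    using arg_cong[OF exchange[of z z], of Re] P.nonneg[of "B p z"]
    by (simp add: P.semi_square Q.semi_square)
  have iter: "(Q.semi z)\<^sup>2 \<le> (\<Sum>j<J. (P.semi ((B q ^^ j) z))\<^sup>2) + (Q.semi ((B q ^^ J) z))\<^sup>2" for z J
  proof (induction J)
    case (Suc J)
    then show ?case using step[of "(B q ^^ J) z"] by simp
  qed simp
  have "(\<Sum>k\<in>index_box (set js) N. (Q.semi (?z k))\<^sup>2)
      \<le> (norm y)\<^sup>2 + (\<Sum>k\<in>index_box (set js) N. (Q.semi ((B q ^^ J) (?z k)))\<^sup>2)" if "N \<le> J" for J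
  proof -
    have "(\<Sum>k\<in>index_box (set js) N. \<Sum>j<J. (P.semi ((B q ^^ j) (?z k)))\<^sup>2)
        \<le> (\<Sum>k\<in>index_box (set js) J. \<Sum>j<J. (P.semi ((B q ^^ j) (?z k)))\<^sup>2)"
      using that by (intro sum_mono2 finite_index_box index_box_mono) (auto intro: sum_nonneg)
    also have "\<dots> = (\<Sum>j<J. \<Sum>k\<in>index_box (set js) J. (P.semi ((B q ^^ j) (?z k)))\<^sup>2)"
      by (rule sum.swap)
    also have "\<dots> = (\<Sum>j<J. \<Sum>k\<in>index_box (set js) J. (P.semi (mpow (k(q := j)) y))\<^sup>2)"
    proof (intro sum.cong refl)
      fix j k
      have "list_power B js (k(q := j)) y = ?z k" by (rule list_power_cong) (use q_js in auto)
      then show "(P.semi ((B q ^^ j) (?z k)))\<^sup>2 = (P.semi (mpow (k(q := j)) y))\<^sup>2"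
        by (simp add: mpow_def)
    qed
    also have "\<dots> = energy J y"
      unfolding energy_def I_def list.set by (rule sum_index_box_insert[OF q_js, symmetric])
    also have "\<dots> \<le> (norm y)\<^sup>2" by (rule energy_le)
    finally have "(\<Sum>k\<in>index_box (set js) N. \<Sum>j<J. (P.semi ((B q ^^ j) (?z k)))\<^sup>2) \<le> (norm y)\<^sup>2" .
    moreover have "(\<Sum>k\<in>index_box (set js) N. (Q.semi (?z k))\<^sup>2)
        \<le> (\<Sum>k\<in>index_box (set js) N. (\<Sum>j<J. (P.semi ((B q ^^ j) (?z k)))\<^sup>2)
          + (Q.semi ((B q ^^ J) (?z k)))\<^sup>2)"
      by (intro sum_mono iter)
    ultimately show ?thesis by (simp add: sum.distrib)
  qed
  moreover have "(\<lambda>J. (norm y)\<^sup>2 + (\<Sum>k\<in>index_box (set js) N. (Q.semi ((B q ^^ J) (?z k)))\<^sup>2))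
      \<longlonglongrightarrow> (norm y)\<^sup>2 + (\<Sum>k\<in>index_box (set js) N. 0)"
  proof (intro tendsto_intros)
    fix k
    show "(\<lambda>J. (Q.semi ((B q ^^ J) (?z k)))\<^sup>2) \<longlonglongrightarrow> 0"
    proof (rule Lim_null_comparison)
      show "\<forall>\<^sub>F J in sequentially. norm ((Q.semi ((B q ^^ J) (?z k)))\<^sup>2)
          \<le> 2 ^ Suc (length js) * (norm ((B q ^^ J) (?z k)) * norm ((B q ^^ J) (?z k)))"
      proof (intro always_eventually allI)
        fix J
        show "norm ((Q.semi ((B q ^^ J) (?z k)))\<^sup>2)
          \<le> 2 ^ Suc (length js) * (norm ((B q ^^ J) (?z k)) * norm ((B q ^^ J) (?z k)))"
          using order_trans[OF complex_Re_le_cmod Q_bounded[of "(B q ^^ J) (?z k)" "(B q ^^ J) (?z k)"]]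
          by (simp add: Q.semi_square Q.nonneg)
      qed
      have "(\<lambda>J. norm ((B q ^^ J) (?z k))) \<longlonglongrightarrow> 0" using pure by simp
      then have "(\<lambda>J. 2 ^ Suc (length js) * (norm ((B q ^^ J) (?z k)) * norm ((B q ^^ J) (?z k))))
          \<longlonglongrightarrow> 2 ^ Suc (length js) * (0 * 0)"
        by (intro tendsto_intros)
      then show "(\<lambda>J. 2 ^ Suc (length js) * (norm ((B q ^^ J) (?z k)) * norm ((B q ^^ J) (?z k))))
          \<longlonglongrightarrow> 0" by simp
    qed
  qed
  ultimately have "(\<Sum>k\<in>index_box (set js) N. (Q.semi (?z k))\<^sup>2)
      \<le> (norm y)\<^sup>2 + (\<Sum>k\<in>index_box (set js) N. 0)"
    by (intro LIMSEQ_le_const) auto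
  then show ?thesis by simp
qed

section \<open>The counterpart of the deleted operator in the shift model\<close>

text \<open>Telescoping \<open>g = C g + E (B q g) + e g\<close>, with the defect \<open>e g\<close>, along the powers of \<open>B q\<close>.
  Applying \<open>B p\<close> to this expansion expresses \<open>B p g\<close> through the transfer function, up to the defects
  and a remainder.\<close>

lemma resolvent_expansion:
  fixes C E :: "'a \<Rightarrow> 'a"
  assumes E: "clinear E"
  shows "g = (\<Sum>j<n. (E ^^ j) (C ((B q ^^ j) g)
      + ((B q ^^ j) g - (C ((B q ^^ j) g) + E (B q ((B q ^^ j) g)))))) + (E ^^ n) ((B q ^^ n) g)"
proof (induction n)
  case (Suc n)
  define u where "u = (B q ^^ n) g"
  have En: "clinear (E ^^ n)" by (rule clinear_funpow[OF E])
  have "(E ^^ n) u = (E ^^ n) (C u + (u - (C u + E (B q u)))) + (E ^^ n) (E (B q u))"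
    by (simp flip: clinear_add[OF En])
  moreover have "(E ^^ n) (E (B q u)) = (E ^^ Suc n) ((B q ^^ Suc n) g)"
    by (simp add: u_def funpow_swap1)
  ultimately show ?case
    using Suc.IH by (simp only: sum.lessThan_Suc u_def[symmetric] add.assoc)
qed simp

text \<open>This is the part of the error in representing \<open>B p\<close> that comes from truncating in the direction
  \<open>q\<close>. Along each line in that direction, it consists of the free outputs of the system started in
  a state that does not depend on the point of the line, namely \<open>(B q ^^ N) h\<close> moved by the other
  operators. Hence their energy is at most \<open>Q\<close> of this state, and \<open>Q_energy\<close> sums over the lines.\<close>

lemma truncation_energy:
  assumes sys: "contractive_system P Q (B p) C E"
  shows "L2_set (\<lambda>k. P.semi (B p ((E ^^ (N - k q)) ((B q ^^ (N - k q)) (mpow k h))))) (index_box I N)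
    \<le> norm ((B q ^^ N) h)"
proof -
  interpret sys: contractive_system P Q "B p" C E by (rule sys)
  define y where "y = (B q ^^ N) h"
  have q_js: "q \<notin> set js" using distinct by simp
  let ?F = "\<lambda>k. (P.semi (B p ((E ^^ (N - k q)) ((B q ^^ (N - k q)) (mpow k h)))))\<^sup>2"
  let ?z = "\<lambda>k. list_power B js k y"
  have eq: "?F (k(q := j)) = (P.semi (B p ((E ^^ (N - j)) (?z k))))\<^sup>2" if "j < N" for j k
  proof -
    have "list_power B js (k(q := j)) h = list_power B js k h"
      by (rule list_power_cong) (use q_js in auto)
    then have "(B q ^^ (N - j)) (mpow (k(q := j)) h) = (B q ^^ N) (list_power B js k h)"
      using that by (simp add: mpow_def flip: funpow_add[THEN fun_cong, unfolded comp_apply])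
    also have "\<dots> = ?z k"
      unfolding y_def using comm
      by (intro list_power_commute[symmetric] funpow_commute) auto
    finally show ?thesis by simp
  qed
  have line: "(\<Sum>j<N. (P.semi (B p ((E ^^ (N - j)) z)))\<^sup>2) \<le> (Q.semi z)\<^sup>2" for z
  proof -
    have "(\<Sum>j<N. (P.semi (B p ((E ^^ (N - j)) z)))\<^sup>2)
        = (\<Sum>j<N. (P.semi (B p ((E ^^ Suc (N - Suc j)) z)))\<^sup>2)"
      by (intro sum.cong refl) (simp only: lessThan_iff Suc_diff_Suc)
    also have "\<dots> = (\<Sum>j<N. (P.semi (B p ((E ^^ Suc j) z)))\<^sup>2)"
      by (rule sum.nat_diff_reindex)
    also have "\<dots> \<le> (Q.semi z)\<^sup>2"
      using sys.free_dissipation[where m = N and v = z] by (smt (verit) zero_le_power2)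
    finally show ?thesis .
  qed
  have "(\<Sum>k\<in>index_box I N. ?F k) = (\<Sum>j<N. \<Sum>k\<in>index_box (set js) N. ?F (k(q := j)))"
    unfolding I_def list.set by (rule sum_index_box_insert[OF q_js])
  also have "\<dots> = (\<Sum>j<N. \<Sum>k\<in>index_box (set js) N. (P.semi (B p ((E ^^ (N - j)) (?z k))))\<^sup>2)"
    by (intro sum.cong refl eq) simp
  also have "\<dots> = (\<Sum>k\<in>index_box (set js) N. \<Sum>j<N. (P.semi (B p ((E ^^ (N - j)) (?z k))))\<^sup>2)"
    by (rule sum.swap)
  also have "\<dots> \<le> (\<Sum>k\<in>index_box (set js) N. (Q.semi (?z k))\<^sup>2)"
    by (intro sum_mono line)
  also have "\<dots> \<le> (norm y)\<^sup>2" by (rule Q_energy)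
  finally have "sqrt (\<Sum>k\<in>index_box I N. ?F k) \<le> norm y"
    by (simp add: real_le_lsqrt sum_nonneg)
  then show ?thesis by (simp only: L2_set_def y_def)
qed

text \<open>What is used of the counterpart of \<open>B p\<close>: its symbol depends on the variable \<open>w q\<close> only, with
  values that are contractions, and it respects truncation.\<close>

definition model_operator ::
  "(((nat \<Rightarrow> nat) \<Rightarrow> 'a) \<Rightarrow> (nat \<Rightarrow> nat) \<Rightarrow> 'a) \<Rightarrow> (complex \<Rightarrow> 'a \<Rightarrow> 'a) \<Rightarrow> bool" where
  "model_operator \<Psi> \<sigma> \<longleftrightarrow> has_symbol I \<Psi> (\<lambda>w. \<sigma> (w q)) \<and>
    (\<forall>w. clinear (\<sigma> w)) \<and> (\<forall>w v. cmod w = 1 \<longrightarrow> P.semi (\<sigma> w v) \<le> P.semi v) \<and>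
    (\<forall>x y k. \<Psi> (\<lambda>k. x k - y k) k = \<Psi> x k - \<Psi> y k) \<and>
    (\<forall>x N. (\<forall>k. k \<notin> index_box I N \<longrightarrow> x k = 0) \<longrightarrow> (\<forall>k. k \<notin> index_box I N \<longrightarrow> \<Psi> x k = 0))"

lemma raise_outside:
  assumes "i \<in> I" "k \<notin> index_box I N" shows "k(i := k i + j) \<notin> index_box I N"
proof
  assume *: "k(i := k i + j) \<in> index_box I N"
  have "k i' < N" if "i' \<in> I" for i'
  proof -
    have "(k(i := k i + j)) i' < N" using * that by (auto simp: index_box_def PiE_iff)
    then show ?thesis by (auto split: if_splits)
  qed
  moreover have "k i' = undefined" if "i' \<notin> I" for i'
  proof -
    have "(k(i := k i + j)) i' = undefined" using * that by (auto simp: index_box_def PiE_iff extensional_def)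
    then show ?thesis using assms(1) that by (auto split: if_splits)
  qed
  ultimately have "k \<in> index_box I N" by (simp add: index_box_def PiE_iff extensional_def)
  then show False using assms(2) by simp
qed

text \<open>The operator is the Cesaro mean of the transfer function, with \<open>w\<close> replaced by the \<open>q\<close>-th
  backward shift. There are three sources of error: the defect of the realisation, made small by \<open>\<epsilon>\<close>;
  the difference between the Cesaro mean and the power series on the first \<open>N\<close> coefficients, made
  small by \<open>J\<close>; and the truncation, which leaves the term \<open>norm ((B q ^^ N) h)\<close>; by purity it vanishes
  as \<open>N\<close> grows.\<close>

lemma approximate_model_operator:
  obtains \<Psi> \<sigma> where "model_operator \<Psi> \<sigma>"
    and "\<And>h. P.seq_norm I N (\<lambda>k. \<Psi> (orbit N h) k - orbit N (B p h) k)
      \<le> norm h / real (Suc N) + norm ((B q ^^ N) h)"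
proof -
  \<comment> \<open>The first two sources of error add up to at most \<open>2 * N * \<theta> * norm h\<close> at each point of the box,
     hence to at most \<open>2 * N * \<theta> * \<kappa> * norm h\<close> in norm.\<close>
  define \<kappa> where "\<kappa> = sqrt (real (card (index_box I N)))"
  define \<theta> where "\<theta> = 1 / (2 * (real (Suc N))\<^sup>2 * (\<kappa> + 1))"
  have \<kappa>: "0 \<le> \<kappa>" by (simp add: \<kappa>_def)
  have den: "1 \<le> 2 * (real (Suc N))\<^sup>2 * (\<kappa> + 1)"
  proof -
    have "1 \<le> (real (Suc N))\<^sup>2" by (rule one_le_power) simp
    then have "1 * 1 \<le> (2 * (real (Suc N))\<^sup>2) * (\<kappa> + 1)"
      using \<kappa> by (intro mult_mono) linarith+
    then show ?thesis by simp
  qed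
  have "0 < 1 / D \<and> 1 / D \<le> 1" if "1 \<le> D" for D :: real using that by simp
  from this[OF den] have \<theta>: "0 < \<theta>" "\<theta> \<le> 1" unfolding \<theta>_def by blast+
  obtain C E where C: "clinear C" and E: "clinear E"
    and W1: "\<And>u v. (P.semi (B p (C u + E v)))\<^sup>2 + (Q.semi (C u + E v))\<^sup>2 \<le> (P.semi u)\<^sup>2 + (Q.semi v)\<^sup>2"
    and W2: "\<And>h. (P.semi (B p (h - (C h + E (B q h)))))\<^sup>2 + (Q.semi (h - (C h + E (B q h))))\<^sup>2
      \<le> \<theta>\<^sup>2 * (norm h)\<^sup>2"
    using contractive_realisation[of "\<theta>\<^sup>2"] \<theta> by auto
  interpret sys: contractive_system P Q "B p" C E
    using C E W1 a by unfold_locales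
  \<comment> \<open>For this \<open>J\<close> the Cesaro weights of the first \<open>N\<close> coefficients differ from 1 by at most \<open>\<theta>\<close>.\<close>
  obtain J :: nat where "(real N + 1) / \<theta> < real J" using reals_Archimedean2 by blast
  then have J\<theta>: "real N + 1 < real J * \<theta>" using \<theta> by (simp add: field_simps)
  also have "\<dots> \<le> real J" using \<theta> by (simp add: mult_left_le)
  finally have J: "N < J" by simp
  define c where "c j = complex_of_real ((real J - real j) / real J)" for j
  define \<Psi> where "\<Psi> x k = (\<Sum>j<J. c j *\<^sub>C sys.markov j (x (k(q := k q + j))))"
    for x :: "(nat \<Rightarrow> nat) \<Rightarrow> 'a" and k
  have ces: "sys.cesaro J w v = (\<Sum>j<J. c j *\<^sub>C w ^ j *\<^sub>C sys.markov j v)" for w v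
    by (simp add: sys.cesaro_def c_def)
  have "model_operator \<Psi> (sys.cesaro J)"
    unfolding model_operator_def
  proof (intro conjI allI impI)
    show "has_symbol I \<Psi> (\<lambda>w. sys.cesaro J (w q))"
      unfolding \<Psi>_def ces by (intro has_symbol_sum has_symbol_shift sys.clinear_markov) simp_all
    show "clinear (sys.cesaro J w)" for w by (rule sys.clinear_cesaro)
    show "P.semi (sys.cesaro J w v) \<le> P.semi v" if "cmod w = 1" for w v
      using that J by (intro sys.semi_cesaro) auto
    show "\<Psi> (\<lambda>k. x k - y k) k = \<Psi> x k - \<Psi> y k" for x y k
      by (simp add: \<Psi>_def clinear_diff[OF sys.clinear_markov] scaleC_diff_right sum_subtractf)
    show "\<Psi> x k = 0" if "\<forall>k. k \<notin> index_box I N \<longrightarrow> x k = 0" "k \<notin> index_box I N" for x k N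
      using that raise_outside[OF q_I that(2)] by (simp add: \<Psi>_def clinear_zero[OF sys.clinear_markov])
  qed
  moreover have "P.seq_norm I N (\<lambda>k. \<Psi> (orbit N h) k - orbit N (B p h) k)
      \<le> norm h / real (Suc N) + norm ((B q ^^ N) h)" for h
  proof -
    define tail where "tail k = P.semi (B p ((E ^^ (N - k q)) ((B q ^^ (N - k q)) (mpow k h))))" for k
    define e where "e u = u - (C u + E (B q u))" for u
    have e_small: "P.semi (B p ((E ^^ j) (e u))) \<le> \<theta> * norm u" for j u
    proof -
      have "(P.semi (B p (e u)))\<^sup>2 \<le> (\<theta> * norm u)\<^sup>2" "(Q.semi (e u))\<^sup>2 \<le> (\<theta> * norm u)\<^sup>2"
        using W2[of u] unfolding e_def power_mult_distrib by (smt (verit) zero_le_power2)+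
      then have "P.semi (B p (e u)) \<le> \<theta> * norm u" "Q.semi (e u) \<le> \<theta> * norm u"
        using \<theta> by (auto intro: power2_le_imp_le)
      then show ?thesis
        using sys.semi_free_response[of "j - 1" "e u"] by (cases j) auto
    qed
    have point: "P.semi (\<Psi> (orbit N h) k - orbit N (B p h) k)
        \<le> 2 * real N * \<theta> * norm h + tail k" if k: "k \<in> index_box I N" for k
    proof -
      define g where "g j = (B q ^^ j) (mpow k h)" for j
      define n where "n = N - k q"
      have kq: "k q < N" using k by (auto simp: index_box_def I_def)
      have n: "n \<le> N" "n \<le> J" using J by (auto simp: n_def)
      have g_norm: "norm (g j) \<le> norm h" for j
        unfolding g_def using contr[of q]
        by (intro order_trans[OF norm_funpow_le norm_mpow_le]) simp
      have orb: "orbit N h (k(q := k q + j)) = (if j < n then g j else 0)" for j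
      proof -
        have "k(q := k q + j) \<in> index_box I N \<longleftrightarrow> j < n"
          using k kq by (auto simp: index_box_def n_def PiE_iff extensional_def I_def)
        then show ?thesis by (simp add: orbit_def g_def mpow_shift)
      qed
      have "\<Psi> (orbit N h) k = (\<Sum>j<J. if j < n then c j *\<^sub>C sys.markov j (g j) else 0)"
        unfolding \<Psi>_def orb by (intro sum.cong refl) (simp add: clinear_zero[OF sys.clinear_markov])
      also have "\<dots> = (\<Sum>j<n. c j *\<^sub>C sys.markov j (g j))"
        using n by (simp add: sum.If_cases lessThan_def[symmetric] Int_absorb1 subset_eq
            flip: lessThan_def)
      finally have \<Psi>: "\<Psi> (orbit N h) k = (\<Sum>j<n. c j *\<^sub>C sys.markov j (g j))" .
      have g_Suc: "g (Suc j) = B q (g j)" for j by (simp add: g_def)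
      have "orbit N (B p h) k = B p (g 0)"
        using k by (simp add: orbit_def g_def mpow_commute)
      also have "g 0 = (\<Sum>j<n. (E ^^ j) (C (g j) + e (g j))) + (E ^^ n) (g n)"
        unfolding e_def g_def funpow_0 by (rule resolvent_expansion[OF E])
      also have "B p \<dots> = (\<Sum>j<n. sys.markov j (g j) + B p ((E ^^ j) (e (g j)))) + B p ((E ^^ n) (g n))"
        by (simp add: clinear_add[OF a] clinear_sum[OF a] clinear_add[OF clinear_funpow[OF E]]
            sys.markov_def)
      finally have orb_p: "orbit N (B p h) k - \<Psi> (orbit N h) k
          = (\<Sum>j<n. (1 - c j) *\<^sub>C sys.markov j (g j) + B p ((E ^^ j) (e (g j)))) + B p ((E ^^ n) (g n))"
        by (simp add: \<Psi> scaleC_diff_left sum_subtractf sum.distrib)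
      have summand: "P.semi ((1 - c j) *\<^sub>C sys.markov j (g j) + B p ((E ^^ j) (e (g j))))
          \<le> 2 * (\<theta> * norm h)" if j: "j < n" for j
      proof -
        have "1 - c j = complex_of_real (1 - (real J - real j) / real J)"
          unfolding c_def by (simp only: of_real_diff of_real_1)
        also have "1 - (real J - real j) / real J = real j / real J"
          using J by (simp add: field_simps)
        finally have "cmod (1 - c j) = real j / real J" by (simp del: of_real_divide)
        moreover have "real j / real J \<le> \<theta>"
        proof -
          have "real j \<le> real J * \<theta>" using J\<theta> j n by linarith
          then show ?thesis using J by (simp add: field_simps)
        qed
        moreover have "P.semi (sys.markov j (g j)) \<le> norm h"
          by (rule order_trans[OF sys.semi_markov order_trans[OF P_semi_le_norm g_norm]])
        ultimately have "P.semi ((1 - c j) *\<^sub>C sys.markov j (g j)) \<le> \<theta> * norm h"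
          unfolding P.semi_scaleC using \<theta> by (intro mult_mono) auto
        moreover have "P.semi (B p ((E ^^ j) (e (g j)))) \<le> \<theta> * norm h"
          by (rule order_trans[OF e_small]) (use \<theta> g_norm in \<open>simp add: mult_left_mono\<close>)
        ultimately show ?thesis
          using P.semi_triangle[of "(1 - c j) *\<^sub>C sys.markov j (g j)" "B p ((E ^^ j) (e (g j)))"]
          by simp
      qed
      have "P.semi (\<Psi> (orbit N h) k - orbit N (B p h) k)
          = P.semi (orbit N (B p h) k - \<Psi> (orbit N h) k)"
        by (rule P.semi_minus_commute)
      also have "\<dots> \<le> (\<Sum>j<n. 2 * (\<theta> * norm h)) + tail k"
        unfolding orb_p tail_def n_def[symmetric] g_def[symmetric]
        by (intro order_trans[OF P.semi_triangle] add_right_mono order_trans[OF P.semi_sum] sum_mono summand)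
          simp
      also have "\<dots> \<le> 2 * real N * \<theta> * norm h + tail k"
      proof -
        have "real n * (2 * (\<theta> * norm h)) \<le> real N * (2 * (\<theta> * norm h))"
          using n \<theta> by (intro mult_right_mono) auto
        then show ?thesis by (simp add: mult_ac)
      qed
      finally show ?thesis .
    qed
    have "P.seq_norm I N (\<lambda>k. \<Psi> (orbit N h) k - orbit N (B p h) k)
        \<le> L2_set (\<lambda>k. 2 * real N * \<theta> * norm h + tail k) (index_box I N)"
      unfolding P.seq_norm_def by (intro L2_set_mono point) auto
    also have "\<dots> \<le> L2_set (\<lambda>k. 2 * real N * \<theta> * norm h) (index_box I N) + L2_set tail (index_box I N)"
      by (rule L2_set_triangle_ineq)
    also have "L2_set (\<lambda>k. 2 * real N * \<theta> * norm h) (index_box I N) = 2 * real N * \<theta> * norm h * \<kappa>"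
      using \<theta> by (simp add: L2_set_def \<kappa>_def real_sqrt_mult real_sqrt_abs abs_mult)
    also have "2 * real N * \<theta> * norm h * \<kappa> \<le> norm h / real (Suc N)"
    proof -
      have "2 * real N * \<theta> * \<kappa> \<le> 2 * real (Suc N) * \<theta> * (\<kappa> + 1)"
        using \<theta> \<kappa> by (intro mult_mono) auto
      also have "\<dots> = 1 / real (Suc N)"
        using \<kappa> unfolding \<theta>_def by (simp add: power2_eq_square divide_simps)
      finally have "2 * real N * \<theta> * \<kappa> * norm h \<le> 1 / real (Suc N) * norm h"
        by (intro mult_right_mono) auto
      then show ?thesis by (simp add: mult_ac)
    qed
    also have "L2_set tail (index_box I N) \<le> norm ((B q ^^ N) h)"
      unfolding tail_def by (rule truncation_energy[OF sys.contractive_system_axioms])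
    finally show ?thesis by simp
  qed
  ultimately show thesis by (rule that)
qed

section \<open>Von Neumann's inequality by freezing the shift variables\<close>

text \<open>Monomials are represented by words in the indices, since the order of the factors matters until
  commutativity has been used.\<close>

definition letter_operator ::
  "(((nat \<Rightarrow> nat) \<Rightarrow> 'a) \<Rightarrow> (nat \<Rightarrow> nat) \<Rightarrow> 'a) \<Rightarrow> nat \<Rightarrow> ((nat \<Rightarrow> nat) \<Rightarrow> 'a) \<Rightarrow> (nat \<Rightarrow> nat) \<Rightarrow> 'a" where
  "letter_operator \<Psi> i = (if i = p then \<Psi> else shift i)"

definition letter_symbol :: "(complex \<Rightarrow> 'a \<Rightarrow> 'a) \<Rightarrow> (nat \<Rightarrow> complex) \<Rightarrow> nat \<Rightarrow> 'a \<Rightarrow> 'a" where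
  "letter_symbol \<sigma> w i = (if i = p then \<sigma> (w q) else (\<lambda>v. w i *\<^sub>C v))"

lemma letter_symbol:
  assumes "model_operator \<Psi> \<sigma>" "i \<in> set (p # q # js)"
  shows "has_symbol I (letter_operator \<Psi> i) (\<lambda>w. letter_symbol \<sigma> w i)"
proof (cases "i = p")
  case True
  then show ?thesis
    using assms by (simp add: letter_operator_def letter_symbol_def model_operator_def)
next
  case False
  then have "i \<in> I" using assms(2) by (auto simp: I_def)
  then have "has_symbol I (shift i) (\<lambda>w v. w i *\<^sub>C v)"
    using has_symbol_shift[of I i "\<lambda>v. v" 1] by (simp add: shift_def[abs_def] clinear_def)
  then show ?thesis using False by (simp add: letter_operator_def letter_symbol_def)
qed

lemma word_symbol:
  assumes "model_operator \<Psi> \<sigma>" "set ws \<subseteq> set (p # q # js)"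
  shows "has_symbol I (foldr (letter_operator \<Psi>) ws) (\<lambda>w. foldr (letter_symbol \<sigma> w) ws)"
  using assms(2)
proof (induction ws)
  case Nil
  show ?case using has_symbol_id[of I] by (simp add: id_def)
next
  case (Cons i ws)
  then have "has_symbol I (\<lambda>x. letter_operator \<Psi> i (foldr (letter_operator \<Psi>) ws x))
      (\<lambda>w v. letter_symbol \<sigma> w i (foldr (letter_symbol \<sigma> w) ws v))"
    by (intro has_symbol_comp[OF letter_symbol[OF assms(1)]]) auto
  then show ?case by (simp add: comp_def)
qed

lemma word_symbol_eq:
  assumes "model_operator \<Psi> \<sigma>"
  shows "foldr (letter_symbol \<sigma> w) ws v
    = prod_list (map (w(p := 1)) ws) *\<^sub>C (\<sigma> (w q) ^^ count_list ws p) v"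
proof -
  have "clinear (\<sigma> (w q))" using assms by (simp add: model_operator_def)
  then show ?thesis
    by (induction ws) (simp_all add: letter_symbol_def clinear_scaleC scaleC_scaleC)
qed

lemma prod_list_word:
  "prod_list (map (w(p := z)) ws) = prod_list (map (w(p := 1)) ws) * (z::complex) ^ count_list ws p"
  by (induction ws) simp_all

text \<open>For fixed \<open>w\<close> on the torus, a polynomial in the model operators has as its symbol a polynomial
  in the single contraction \<open>\<sigma> (w q)\<close>, to which the one-variable inequality applies.\<close>

lemma model_von_neumann:
  assumes model: "model_operator \<Psi> \<sigma>" and K: "finite K"
    and ws: "\<And>s. s \<in> K \<Longrightarrow> set (ws s) \<subseteq> set (p # q # js)"
    and M: "\<And>z. (\<And>i. i \<in> set (p # q # js) \<Longrightarrow> cmod (z i) = 1)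
      \<Longrightarrow> cmod (\<Sum>s\<in>K. c s * prod_list (map z (ws s))) \<le> M"
    and x: "\<And>k. k \<notin> index_box I N \<Longrightarrow> x k = 0"
  shows "P.seq_norm I N (\<lambda>k. \<Sum>s\<in>K. c s *\<^sub>C foldr (letter_operator \<Psi>) (ws s) x k)
    \<le> M * P.seq_norm I N x"
proof (rule P.seq_norm_le_symbol[OF finite_I, where \<Phi> = "\<lambda>x k. \<Sum>s\<in>K. c s *\<^sub>C foldr (letter_operator \<Psi>) (ws s) x k"])
  show "has_symbol I (\<lambda>x k. \<Sum>s\<in>K. c s *\<^sub>C foldr (letter_operator \<Psi>) (ws s) x k)
      (\<lambda>w v. \<Sum>s\<in>K. c s *\<^sub>C foldr (letter_symbol \<sigma> w) (ws s) v)"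
    using ws by (intro has_symbol_sum K word_symbol model) auto
  show "0 \<le> M" using M[of "\<lambda>_. 1"] by (auto intro: order_trans[OF norm_ge_zero])
  show "P.semi (\<Sum>s\<in>K. c s *\<^sub>C foldr (letter_symbol \<sigma> w) (ws s) v) \<le> M * P.semi v"
    if w: "\<And>i. i \<in> I \<Longrightarrow> cmod (w i) = 1" for w v
  proof -
    define a where "a s = c s * prod_list (map (w(p := 1)) (ws s))" for s
    have "P.semi (\<Sum>s\<in>K. a s *\<^sub>C (\<sigma> (w q) ^^ count_list (ws s) p) v) \<le> M * P.semi v"
    proof (rule P.von_neumann_one_variable[OF _ _ K])
      show "clinear (\<sigma> (w q))" "P.semi (\<sigma> (w q) v) \<le> P.semi v" for v
        using model w[OF q_I] by (simp_all add: model_operator_def)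
      show "cmod (\<Sum>s\<in>K. a s * z ^ count_list (ws s) p) \<le> M" if z: "cmod z = 1" for z
      proof -
        have "cmod (\<Sum>s\<in>K. c s * prod_list (map (w(p := z)) (ws s))) \<le> M"
          using w z by (intro M) (auto simp: I_def)
        then show ?thesis by (simp add: prod_list_word[of w z] a_def mult.assoc)
      qed
    qed
    then show ?thesis by (simp add: word_symbol_eq[OF model] a_def scaleC_scaleC)
  qed
qed (rule x)

lemma letter_operator_outside:
  assumes "model_operator \<Psi> \<sigma>" "i \<in> set (p # q # js)"
    and "\<And>k. k \<notin> index_box I N \<Longrightarrow> x k = 0" and "k \<notin> index_box I N"
  shows "letter_operator \<Psi> i x k = 0"
proof (cases "i = p")
  case True
  have "(\<forall>k. k \<notin> index_box I N \<longrightarrow> x k = 0) \<longrightarrow> (\<forall>k. k \<notin> index_box I N \<longrightarrow> \<Psi> x k = 0)"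
    using assms(1) unfolding model_operator_def by blast
  then show ?thesis using assms(3,4) True by (simp add: letter_operator_def)
next
  case False
  then have "i \<in> I" using assms(2) by (auto simp: I_def)
  then show ?thesis
    using assms(3) raise_outside[OF _ assms(4), of i 1] False
    by (simp add: letter_operator_def shift_def)
qed

lemma seq_norm_letter_operator:
  assumes model: "model_operator \<Psi> \<sigma>" and i: "i \<in> set (p # q # js)"
    and x: "\<And>k. k \<notin> index_box I N \<Longrightarrow> x k = 0"
  shows "P.seq_norm I N (letter_operator \<Psi> i x) \<le> P.seq_norm I N x"
  using model_von_neumann[OF model, of "{()}" "\<lambda>_. [i]" "\<lambda>_. 1" 1 N x] i x by simp

lemma word_outside:
  assumes "model_operator \<Psi> \<sigma>" "set ws \<subseteq> set (p # q # js)"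
    and "\<And>k. k \<notin> index_box I N \<Longrightarrow> x k = 0"
  shows "k \<notin> index_box I N \<Longrightarrow> foldr (letter_operator \<Psi>) ws x k = 0"
  using assms(2)
proof (induction ws arbitrary: k)
  case (Cons i ws)
  then show ?case using letter_operator_outside[OF assms(1), of i N] by simp
qed (use assms in simp)

lemma letter_operator_diff:
  assumes "model_operator \<Psi> \<sigma>"
  shows "letter_operator \<Psi> i (\<lambda>k. x k - y k) k = letter_operator \<Psi> i x k - letter_operator \<Psi> i y k"
  using assms by (simp add: letter_operator_def model_operator_def shift_def)

text \<open>The errors made in replacing one letter after the other add up, because the model operators
  are contractive on truncated sequences.\<close>

lemma word_intertwines:
  assumes model: "\<And>N. model_operator (\<Psi> N) (\<sigma> N)"
    and \<Psi>: "\<And>h. (\<lambda>N. P.seq_norm I N (\<lambda>k. \<Psi> N (orbit N h) k - orbit N (B p h) k)) \<longlonglongrightarrow> 0"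
    and ws: "set ws \<subseteq> set (p # q # js)"
  shows "(\<lambda>N. P.seq_norm I N (\<lambda>k. foldr (letter_operator (\<Psi> N)) ws (orbit N h) k
      - orbit N (foldr B ws h) k)) \<longlonglongrightarrow> 0"
  using ws
proof (induction ws)
  case Nil
  show ?case by (simp add: P.seq_norm_zero)
next
  case (Cons i ws)
  define g where "g = foldr B ws h"
  define x where "x N = foldr (letter_operator (\<Psi> N)) ws (orbit N h)" for N
  have i: "i \<in> set (p # q # js)" and ws: "set ws \<subseteq> set (p # q # js)" using Cons.prems by auto
  have letter: "(\<lambda>N. P.seq_norm I N (\<lambda>k. letter_operator (\<Psi> N) i (orbit N g) k - orbit N (B i g) k))
      \<longlonglongrightarrow> 0"
  proof (cases "i = p")
    case True
    then show ?thesis using \<Psi>[of g] by (simp add: letter_operator_def)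
  next
    case False
    then have "i \<in> I" using i by (auto simp: I_def)
    then show ?thesis using shift_intertwines[of i g] False by (simp add: letter_operator_def)
  qed
  have le: "P.seq_norm I N (\<lambda>k. letter_operator (\<Psi> N) i (x N) k - orbit N (B i g) k)
      \<le> P.seq_norm I N (\<lambda>k. x N k - orbit N g k)
        + P.seq_norm I N (\<lambda>k. letter_operator (\<Psi> N) i (orbit N g) k - orbit N (B i g) k)" for N
  proof -
    have "P.seq_norm I N (letter_operator (\<Psi> N) i (\<lambda>k. x N k - orbit N g k))
        \<le> P.seq_norm I N (\<lambda>k. x N k - orbit N g k)"
      using word_outside[OF model ws, of N "orbit N h" _ N] orbit_outside
      by (intro seq_norm_letter_operator[OF model i]) (simp add: x_def)
    then show ?thesis
      using P.seq_norm_triangle[of I N "letter_operator (\<Psi> N) i (\<lambda>k. x N k - orbit N g k)"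
          "\<lambda>k. letter_operator (\<Psi> N) i (orbit N g) k - orbit N (B i g) k"]
      by (simp add: letter_operator_diff[OF model])
  qed
  have "(\<lambda>N. P.seq_norm I N (\<lambda>k. x N k - orbit N g k)
        + P.seq_norm I N (\<lambda>k. letter_operator (\<Psi> N) i (orbit N g) k - orbit N (B i g) k)) \<longlonglongrightarrow> 0 + 0"
    using Cons.IH[OF ws] letter unfolding x_def g_def by (intro tendsto_add)
  then have "(\<lambda>N. P.seq_norm I N (\<lambda>k. letter_operator (\<Psi> N) i (x N) k - orbit N (B i g) k)) \<longlonglongrightarrow> 0"
    unfolding add_0 by (rule Lim_null_comparison[rotated]) (simp add: le)
  then show ?case by (simp add: x_def g_def)
qed

text \<open>Both ends of the inequality for the model, transported along the orbit map, converge to those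
  for the given operators.\<close>

theorem von_neumann:
  assumes K: "finite K" and ws: "\<And>s. s \<in> K \<Longrightarrow> set (ws s) \<subseteq> set (p # q # js)"
    and M: "\<And>z. (\<And>i. i \<in> set (p # q # js) \<Longrightarrow> cmod (z i) = 1)
      \<Longrightarrow> cmod (\<Sum>s\<in>K. c s * prod_list (map z (ws s))) \<le> M"
  shows "norm (\<Sum>s\<in>K. c s *\<^sub>C foldr B (ws s) h) \<le> M * norm h"
proof -
  have "\<exists>\<Psi> \<sigma>. model_operator \<Psi> \<sigma> \<and> (\<forall>h. P.seq_norm I N (\<lambda>k. \<Psi> (orbit N h) k - orbit N (B p h) k)
      \<le> norm h / real (Suc N) + norm ((B q ^^ N) h))" for N
    by (rule approximate_model_operator[of N]) blast
  then obtain \<Psi> \<sigma> where model: "\<And>N. model_operator (\<Psi> N) (\<sigma> N)"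
    and err: "\<And>N h. P.seq_norm I N (\<lambda>k. \<Psi> N (orbit N h) k - orbit N (B p h) k)
      \<le> norm h / real (Suc N) + norm ((B q ^^ N) h)"
    by metis
  have \<Psi>: "(\<lambda>N. P.seq_norm I N (\<lambda>k. \<Psi> N (orbit N h) k - orbit N (B p h) k)) \<longlonglongrightarrow> 0" for h
  proof (rule Lim_null_comparison)
    have "(\<lambda>N. norm h * inverse (real (Suc N)) + norm ((B q ^^ N) h)) \<longlonglongrightarrow> norm h * 0 + 0"
      using pure[of q h] by (intro tendsto_add tendsto_mult tendsto_const LIMSEQ_inverse_real_of_nat) simp
    then show "(\<lambda>N. norm h / real (Suc N) + norm ((B q ^^ N) h)) \<longlonglongrightarrow> 0"
      by (simp add: divide_inverse)
  qed (simp add: err del: of_nat_Suc)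
  define g where "g = (\<Sum>s\<in>K. c s *\<^sub>C foldr B (ws s) h)"
  define d where "d N s = P.seq_norm I N (\<lambda>k. foldr (letter_operator (\<Psi> N)) (ws s) (orbit N h) k
      - orbit N (foldr B (ws s) h) k)" for N s
  have M0: "0 \<le> M" using M[of "\<lambda>_. 1"] by (auto intro: order_trans[OF norm_ge_zero])
  have le: "P.seq_norm I N (orbit N g) \<le> M * norm h + (\<Sum>s\<in>K. cmod (- c s) * d N s)" for N
  proof -
    define y where "y k = (\<Sum>s\<in>K. c s *\<^sub>C foldr (letter_operator (\<Psi> N)) (ws s) (orbit N h) k)" for k
    have y: "P.seq_norm I N y \<le> M * norm h"
    proof -
      have "P.seq_norm I N y \<le> M * P.seq_norm I N (orbit N h)"
        unfolding y_def by (rule model_von_neumann[OF model K ws M orbit_outside])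
      also have "\<dots> \<le> M * norm h" by (intro mult_left_mono seq_norm_orbit_le M0)
      finally show ?thesis .
    qed
    have "orbit N g k = y k + (\<Sum>s\<in>K. (- c s) *\<^sub>C
        (foldr (letter_operator (\<Psi> N)) (ws s) (orbit N h) k - orbit N (foldr B (ws s) h) k))" for k
    proof -
      have "orbit N g k = (\<Sum>s\<in>K. c s *\<^sub>C orbit N (foldr B (ws s) h) k)"
        by (simp add: orbit_def g_def clinear_sum[OF clinear_mpow] clinear_scaleC[OF clinear_mpow])
      then show ?thesis
        by (simp add: y_def scaleC_minus_left scaleC_diff_right sum_subtractf sum_negf)
    qed
    then have "P.seq_norm I N (orbit N g) \<le> P.seq_norm I N y + P.seq_norm I N (\<lambda>k. \<Sum>s\<in>K. (- c s) *\<^sub>C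
        (foldr (letter_operator (\<Psi> N)) (ws s) (orbit N h) k - orbit N (foldr B (ws s) h) k))"
      using P.seq_norm_triangle by (metis (no_types, lifting) ext)
    also have "\<dots> \<le> M * norm h + (\<Sum>s\<in>K. cmod (- c s) * d N s)"
      unfolding d_def by (intro add_mono y P.seq_norm_sum)
    finally show ?thesis .
  qed
  have "(\<lambda>N. M * norm h + (\<Sum>s\<in>K. cmod (- c s) * d N s)) \<longlonglongrightarrow> M * norm h + (\<Sum>s\<in>K. cmod (- c s) * 0)"
    unfolding d_def
    by (intro tendsto_add tendsto_sum tendsto_mult tendsto_const word_intertwines[OF model \<Psi> ws])
  then have "norm g \<le> M * norm h + (\<Sum>s\<in>K. cmod (- c s) * 0)"
    by (rule LIMSEQ_le[OF seq_norm_orbit_tendsto]) (use le in blast)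
  then show ?thesis by (simp add: g_def)
qed

end

section \<open>From tuples of operators to their adjoints\<close>

lemma tuple_power_eq: "tuple_power m T k v = list_power T [1..<Suc m] k v"
proof -
  have "foldr (\<circ>) (map (\<lambda>i. T i ^^ k i) ls) id v = list_power T ls k v" for ls
    by (induction ls) auto
  then show ?thesis unfolding tuple_power_def by blast
qed

lemma list_power_snoc: "list_power B (ls @ [i]) k v = list_power B ls k ((B i ^^ k i) v)"
  by (induction ls) auto

lemma list_power_rev:
  assumes "\<And>i j v. i \<in> set ls \<Longrightarrow> j \<in> set ls \<Longrightarrow> B i (B j v) = B j (B i v)"
  shows "list_power B (rev ls) k v = list_power B ls k v"
  using assms
proof (induction ls)
  case (Cons i ls)
  have "list_power B (rev ls) k ((B i ^^ k i) v) = (B i ^^ k i) (list_power B (rev ls) k v)"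
    using Cons.prems by (intro list_power_commute funpow_commute) auto
  then show ?case using Cons by (simp add: list_power_snoc)
qed simp

lemma cinner_list_power:
  assumes "\<And>i x y. i \<in> set ls \<Longrightarrow> cinner (T i x) y = cinner x (B i y)"
  shows "cinner (list_power T ls k x) y = cinner x (list_power B (rev ls) k y)"
  using assms
proof (induction ls arbitrary: y)
  case (Cons i ls)
  have "cinner ((T i ^^ j) x) y = cinner x ((B i ^^ j) y)" for j x y
    by (induction j arbitrary: x y) (simp_all add: Cons.prems funpow_swap1)
  then show ?case using Cons by (simp add: list_power_snoc)
qed simp

text \<open>Splitting off the last exponent \<open>k (Suc m) \<in> {0, 1}\<close> reproduces the recursion of
  \<open>szego_form\<close>; this is why the list is reversed.\<close>

lemma sum_list_power_szego_form:
  "(\<Sum>k \<in> {1..m} \<rightarrow>\<^sub>E {0, 1}. (-1) ^ (\<Sum>i=1..m. k i)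
      * cinner (list_power B [1..<Suc m] k u) (list_power B [1..<Suc m] k v))
    = szego_form (map B (rev [1..<Suc m])) u v"
proof (induction m arbitrary: u v)
  case (Suc m)
  define F where "F u v k = (-1) ^ (\<Sum>i=1..m. k i)
      * cinner (list_power B [1..<Suc m] k u) (list_power B [1..<Suc m] k v)" for u v and k :: "nat \<Rightarrow> nat"
  define G where "G k = (-1) ^ (\<Sum>i=1..Suc m. k i)
      * cinner (list_power B [1..<Suc (Suc m)] k u) (list_power B [1..<Suc (Suc m)] k v)"
    for k :: "nat \<Rightarrow> nat"
  have G: "G (k(Suc m := j)) = (-1) ^ j * F ((B (Suc m) ^^ j) u) ((B (Suc m) ^^ j) v) k" for k j
  proof -
    have "list_power B [1..<Suc m] (k(Suc m := j)) w = list_power B [1..<Suc m] k w" for w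
      by (rule list_power_cong) auto
    moreover have "list_power B [1..<Suc (Suc m)] k' w
        = list_power B [1..<Suc m] k' ((B (Suc m) ^^ k' (Suc m)) w)" for k' w
      using list_power_snoc[of B "[1..<Suc m]" "Suc m" k' w] by simp
    moreover have "(\<Sum>i=1..Suc m. (k(Suc m := j)) i) = j + (\<Sum>i=1..m. k i)" by simp
    ultimately show ?thesis
      by (simp only: G_def F_def power_add fun_upd_same mult.assoc)
  qed
  have ins: "{1..Suc m} = insert (Suc m) {1..m}" by auto
  have "(\<Sum>k \<in> {1..Suc m} \<rightarrow>\<^sub>E {0, 1}. G k)
      = (\<Sum>(j, k) \<in> {0, 1} \<times> ({1..m} \<rightarrow>\<^sub>E {0, 1}). G (k(Suc m := j)))"
    unfolding ins PiE_insert_eq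
    by (subst sum.reindex[OF inj_combinator]) (auto intro!: sum.cong)
  also have "\<dots> = (\<Sum>j\<in>{0, 1}. \<Sum>k \<in> {1..m} \<rightarrow>\<^sub>E {0, 1}. G (k(Suc m := j)))"
    by (rule sum.cartesian_product[symmetric])
  also have "\<dots> = (\<Sum>k \<in> {1..m} \<rightarrow>\<^sub>E {0, 1}. F u v k)
      - (\<Sum>k \<in> {1..m} \<rightarrow>\<^sub>E {0, 1}. F (B (Suc m) u) (B (Suc m) v) k)"
    by (simp add: G sum_negf)
  also have "\<dots> = szego_form (map B (rev [1..<Suc (Suc m)])) u v"
    using Suc.IH by (simp add: F_def)
  finally show ?case by (simp only: G_def)
qed simp

lemma szego_inverse_form:
  assumes T: "T \<in> commuting_contractions m"
  shows "cinner (szego_inverse m T h) h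
    = szego_form (map (\<lambda>i. cadjoint (T i)) (rev [1..<Suc m])) h h"
proof -
  define B where "B i = cadjoint (T i)" for i
  have adj: "cinner (T i x) y = cinner x (B i y)" if "i \<in> set [1..<Suc m]" for i x y
    unfolding B_def using T that by (intro cadjoint) (auto simp: commuting_contractions_def)
  have comm: "B i (B j v) = B j (B i v)" if "i \<in> set [1..<Suc m]" "j \<in> set [1..<Suc m]" for i j v
    unfolding B_def using T that by (intro cadjoint_commute) (auto simp: commuting_contractions_def)
  have "cinner (szego_inverse m T h) h = (\<Sum>k \<in> {1..m} \<rightarrow>\<^sub>E {0, 1}. (-1) ^ (\<Sum>i=1..m. k i)
      * cinner (list_power T [1..<Suc m] k (list_power B [1..<Suc m] k h)) h)"
    by (simp add: szego_inverse_def cinner.sum_left cinner.scaleR_left tuple_power_eq B_def[symmetric]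
        del: upt_Suc)
  also have "\<dots> = (\<Sum>k \<in> {1..m} \<rightarrow>\<^sub>E {0, 1}. (-1) ^ (\<Sum>i=1..m. k i)
      * cinner (list_power B [1..<Suc m] k h) (list_power B [1..<Suc m] k h))"
    by (simp only: cinner_list_power[OF adj] list_power_rev[where B = B and ls = "[1..<Suc m]", OF comm])
  also have "\<dots> = szego_form (map B (rev [1..<Suc m])) h h"
    by (rule sum_list_power_szego_form)
  finally show ?thesis by (simp only: B_def[abs_def])
qed

lemma delete_entry_indices:
  assumes "p \<in> {1..n}" "distinct ls" "set ls = {1..n} - {p}"
  shows "mset (map (delete_entry p (\<lambda>i. i)) (rev [1..<Suc (n - 1)])) = mset ls"
proof -
  have "strict_mono (delete_entry p (\<lambda>i. i))"
    by (rule strict_monoI) (auto simp: delete_entry_def)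
  then have "distinct (map (delete_entry p (\<lambda>i. i)) (rev [1..<Suc (n - 1)]))"
    by (simp add: distinct_map strict_mono_imp_inj_on inj_on_subset)
  moreover have "j \<in> delete_entry p (\<lambda>i. i) ` {1..<Suc (n - 1)}" if "j \<in> {1..n} - {p}" for j
  proof (rule image_eqI)
    show "j = delete_entry p (\<lambda>i. i) (if j < p then j else j - 1)"
      using that by (auto simp: delete_entry_def)
    show "(if j < p then j else j - 1) \<in> {1..<Suc (n - 1)}" using that assms(1) by auto
  qed
  moreover have "delete_entry p (\<lambda>i. i) ` {1..<Suc (n - 1)} \<subseteq> {1..n} - {p}"
    using assms(1) by (auto simp: delete_entry_def)
  ultimately show ?thesis
    using assms(2,3) by (subst set_eq_iff_mset_eq_distinct[symmetric]) (auto simp del: upt_Suc)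
qed

lemma szego_form_delete_entry:
  assumes p: "p \<in> {1..n}" and ls: "distinct ls" "set ls = {1..n} - {p}"
    and comm: "\<And>i j v. i \<in> {1..n} \<Longrightarrow> j \<in> {1..n} \<Longrightarrow> cadjoint (T i) (cadjoint (T j) v) = cadjoint (T j) (cadjoint (T i) v)"
    and T: "delete_entry p T \<in> szego_tuples (n - 1)"
  shows "0 \<le> Re (szego_form (map (\<lambda>i. cadjoint (T i)) ls) h h)"
proof -
  let ?As = "map (\<lambda>i. cadjoint (delete_entry p T i)) (rev [1..<Suc (n - 1)])"
  have eq: "?As = map (\<lambda>i. cadjoint (T i)) (map (delete_entry p (\<lambda>i. i)) (rev [1..<Suc (n - 1)]))"
    by (simp add: delete_entry_def del: upt_Suc)
  have "mset ?As = mset (map (\<lambda>i. cadjoint (T i)) ls)"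
    unfolding eq using delete_entry_indices[OF p ls] by (metis mset_map)
  then have "szego_form (map (\<lambda>i. cadjoint (T i)) ls) h h = szego_form ?As h h"
    using comm ls(2) by (intro szego_form_perm) auto
  also have "\<dots> = cinner (szego_inverse (n - 1) (delete_entry p T) h) h"
    using T by (intro szego_inverse_form[symmetric]) (simp add: szego_tuples_def)
  finally show ?thesis
    using T by (simp add: szego_tuples_def positive_op_def complex_nonneg_Reals_iff)
qed

section \<open>Polynomials on the closed polydisc\<close>

text \<open>The supremum is over the open polydisc; boundary points are approached along the radius.\<close>

lemma poly_value_le_SUP:
  assumes z: "\<And>i. i \<in> {1..n} \<Longrightarrow> cmod (z i) \<le> 1"
  shows "cmod (poly_value n f z) \<le> (SUP z \<in> polydisc n. cmod (poly_value n f z))"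
proof -
  define \<rho> where "\<rho> m = real m / real (Suc m)" for m
  have \<rho>_nonneg: "0 \<le> \<rho> m" for m by (simp add: \<rho>_def)
  have bdd: "bdd_above ((\<lambda>z. cmod (poly_value n f z)) ` polydisc n)"
  proof (rule bdd_aboveI2)
    fix w assume w: "w \<in> polydisc n"
    have "cmod (w i) \<le> 1" if "i \<in> {1..n}" for i
      using w that by (auto simp: polydisc_def PiE_iff less_imp_le)
    then have "cmod (\<Prod>i=1..n. w i ^ Poly_Mapping.lookup k i) \<le> 1" for k
      unfolding prod_norm[symmetric] norm_power by (intro prod_le_1) (simp add: power_le_one)
    then show "cmod (poly_value n f w) \<le> (\<Sum>k\<in>Poly_Mapping.keys f. cmod (Poly_Mapping.lookup f k))"
      unfolding poly_value_def by (intro sum_norm_le) (simp add: norm_mult mult_left_le)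
  qed
  have "cmod (poly_value n f (\<lambda>i. complex_of_real (\<rho> m) * z i))
      \<le> (SUP z \<in> polydisc n. cmod (poly_value n f z))" for m
  proof -
    define w where "w = (\<lambda>i\<in>{1..n}. complex_of_real (\<rho> m) * z i)"
    have "cmod (complex_of_real (\<rho> m) * z i) < 1" if "i \<in> {1..n}" for i
    proof -
      have "\<rho> m * cmod (z i) \<le> \<rho> m * 1"
        using z[OF that] by (intro mult_left_mono) (simp_all add: \<rho>_def)
      also have "\<dots> < 1" by (simp add: \<rho>_def)
      finally show ?thesis
        using norm_of_real[of "\<rho> m", where 'a = complex] by (simp add: norm_mult abs_of_nonneg \<rho>_nonneg)
    qed
    then have "w \<in> polydisc n" by (simp add: w_def polydisc_def)
    moreover have "poly_value n f w = poly_value n f (\<lambda>i. complex_of_real (\<rho> m) * z i)"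
      by (simp add: poly_value_def w_def)
    ultimately show ?thesis using cSUP_upper[OF _ bdd] by metis
  qed
  moreover have "(\<lambda>m. cmod (poly_value n f (\<lambda>i. complex_of_real (\<rho> m) * z i)))
      \<longlonglongrightarrow> cmod (poly_value n f (\<lambda>i. complex_of_real 1 * z i))"
    unfolding poly_value_def \<rho>_def by (intro tendsto_intros LIMSEQ_n_over_Suc_n)
  ultimately show ?thesis by (intro LIMSEQ_le_const2[where a = "SUP z \<in> polydisc n. cmod (poly_value n f z)"]) auto
qed

definition word :: "nat list \<Rightarrow> (nat \<Rightarrow> nat) \<Rightarrow> nat list" where
  "word ls k = concat (map (\<lambda>i. replicate (k i) i) ls)"

lemma set_word: "set (word ls k) \<subseteq> set ls"
  by (auto simp: word_def)

lemma foldr_word: "foldr B (word ls k) v = list_power B ls k v"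
proof -
  have "foldr B (replicate m i) u = (B i ^^ m) u" for m i u by (induction m) simp_all
  then show ?thesis by (induction ls) (simp_all add: word_def)
qed

lemma prod_list_word_eq:
  "prod_list (map z (word ls k)) = prod_list (map (\<lambda>i. (z i :: complex) ^ k i) ls)"
  by (induction ls) (simp_all add: word_def prod_list_replicate)

section \<open>Von Neumann's inequality for the tuple\<close>

theorem theorem5p4:
  fixes n p q :: nat
    and T :: "nat \<Rightarrow> 'a::chilbert_space \<Rightarrow> 'a"
    and f :: cmpoly
  assumes "3 \<le> n" and "1 \<le> p" and "p < q" and "q \<le> n"
    and "T \<in> tuples_pq n p q"
    and "f \<in> polynomials_in n"
  shows "onorm (poly_op n f T) \<le> (SUP z \<in> polydisc n. cmod (poly_value n f z))"
proof -
  define B where "B i = cadjoint (T i)" for i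
  define js where "js = filter (\<lambda>i. i \<noteq> p \<and> i \<noteq> q) [1..<Suc n]"
  have T: "T \<in> commuting_contractions n"
    and pT: "delete_entry p T \<in> szego_tuples (n - 1)"
    and qT: "delete_entry q T \<in> szego_tuples (n - 1)"
    and pure_T: "pure_tuple (n - 1) (delete_entry p T)"
    using assms(5) by (simp_all add: tuples_pq_def)
  have pq: "p \<in> {1..n}" "q \<in> {1..n}" "p \<noteq> q" using assms(2-4) by auto
  have sets: "distinct (q # js)" "set (q # js) = {1..n} - {p}"
    "distinct (p # js)" "set (p # js) = {1..n} - {q}" "set (p # q # js) = {1..n}"
    using pq by (auto simp: js_def)
  have adj: "cinner (T i x) y = cinner x (B i y)" if "i \<in> {1..n}" for i x y
    unfolding B_def using T that by (intro cadjoint) (auto simp: commuting_contractions_def)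
  have comm: "B i (B j v) = B j (B i v)" if "i \<in> {1..n}" "j \<in> {1..n}" for i j v
    unfolding B_def using T that by (intro cadjoint_commute) (auto simp: commuting_contractions_def)
  interpret szego_pair B p q js
  proof (rule szego_pair.intro)
    show "distinct (p # q # js)" using sets pq by auto
    show "clinear (B i)" if "i \<in> set (p # q # js)" for i
      unfolding B_def using that T sets(5)
      by (intro clinear_cadjoint) (auto simp: commuting_contractions_def)
    show "norm (B i v) \<le> norm v" if "i \<in> set (p # q # js)" for i v
      unfolding B_def using that T sets(5)
      by (intro norm_cadjoint_le) (auto simp: commuting_contractions_def)
    show "B i (B j v) = B j (B i v)" if "i \<in> set (p # q # js)" "j \<in> set (p # q # js)" for i j v
      using that unfolding sets(5) by (rule comm)
    show "0 \<le> Re (szego_form (map B (q # js)) h h)" for h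
      unfolding B_def[abs_def]
      using pq(1) sets(1,2) comm[unfolded B_def] pT by (rule szego_form_delete_entry)
    show "0 \<le> Re (szego_form (map B (p # js)) h h)" for h
      unfolding B_def[abs_def]
      using pq(2) sets(3,4) comm[unfolded B_def] qT by (rule szego_form_delete_entry)
    show "(\<lambda>r. norm ((B i ^^ r) h)) \<longlonglongrightarrow> 0" if "i \<in> set (q # js)" for i h
    proof -
      define j where "j = (if i < p then i else i - 1)"
      have i: "i \<in> {1..n} - {p}" using that by (simp only: sets(2))
      then have "delete_entry p T j = T i" "j \<in> {1..n - 1}"
        using pq(1) by (auto simp: j_def delete_entry_def)
      then show ?thesis using pure_T unfolding pure_tuple_def B_def by metis
    qed
  qed
  have letters: "set (rev [1..<Suc n]) = {1..n}" by auto
  define M where "M = (SUP z \<in> polydisc n. cmod (poly_value n f z))"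
  \<comment> \<open>\<open>F\<close> is the adjoint of \<open>f(T)\<close>, a polynomial in the adjoints with conjugated coefficients and
     reversed monomials.\<close>
  define F where "F y = (\<Sum>k\<in>Poly_Mapping.keys f. cnj (Poly_Mapping.lookup f k)
      *\<^sub>C foldr B (word (rev [1..<Suc n]) (Poly_Mapping.lookup k)) y)" for y
  have F: "norm (F y) \<le> M * norm y" for y
    unfolding F_def
  proof (rule von_neumann)
    show "set (word (rev [1..<Suc n]) (Poly_Mapping.lookup k)) \<subseteq> set (p # q # js)" for k
      unfolding sets(5) letters[symmetric] by (rule set_word)
  next
    fix z :: "nat \<Rightarrow> complex" assume z: "\<And>i. i \<in> set (p # q # js) \<Longrightarrow> cmod (z i) = 1"
    have prod: "prod_list (map z (word (rev [1..<Suc n]) k)) = (\<Prod>i=1..n. z i ^ k i)" for k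
    proof -
      have "prod_list (map z (word (rev [1..<Suc n]) k)) = (\<Prod>i\<in>set (rev [1..<Suc n]). z i ^ k i)"
        unfolding prod_list_word_eq by (rule prod.distinct_set_conv_list[symmetric]) (simp del: upt_Suc)
      then show ?thesis unfolding letters .
    qed
    have "(\<Sum>k\<in>Poly_Mapping.keys f. cnj (Poly_Mapping.lookup f k)
        * prod_list (map z (word (rev [1..<Suc n]) (Poly_Mapping.lookup k))))
      = cnj (poly_value n f (\<lambda>i. cnj (z i)))"
      unfolding prod by (simp add: poly_value_def)
    moreover have "cmod (poly_value n f (\<lambda>i. cnj (z i))) \<le> M"
      unfolding M_def using z[unfolded sets(5)] by (intro poly_value_le_SUP) simp
    ultimately show "cmod (\<Sum>k\<in>Poly_Mapping.keys f. cnj (Poly_Mapping.lookup f k)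
        * prod_list (map z (word (rev [1..<Suc n]) (Poly_Mapping.lookup k)))) \<le> M"
      by simp
  qed simp
  have adjoint: "cinner (poly_op n f T x) y = cinner x (F y)" for x y
  proof -
    have "cinner (list_power T [1..<Suc n] k x) y = cinner x (list_power B (rev [1..<Suc n]) k y)" for k
      by (rule cinner_list_power) (use adj in auto)
    then show ?thesis
      by (simp add: poly_op_def F_def cinner.sum_left cinner.sum_right cinner.scale_left
          cinner.scale_right tuple_power_eq foldr_word del: upt_Suc)
  qed
  have M0: "0 \<le> M"
    using poly_value_le_SUP[of n "\<lambda>_. 0" f] unfolding M_def
    by (auto intro: order_trans[OF norm_ge_zero])
  \<comment> \<open>An operator inherits the bound of its adjoint.\<close>
  have "norm (poly_op n f T x) \<le> M * norm x" for x
  proof -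
    define y where "y = poly_op n f T x"
    have "cinner x (F y) = complex_of_real ((norm y)\<^sup>2)"
      unfolding adjoint[symmetric] y_def[symmetric] by (rule cinner_self)
    then have "(norm y)\<^sup>2 = cmod (cinner x (F y))" by (simp del: of_real_power)
    also have "\<dots> \<le> norm x * (M * norm y)"
      by (intro order_trans[OF cmod_cinner_le] mult_left_mono F) simp
    finally have "norm y * norm y \<le> (M * norm x) * norm y"
      by (simp add: power2_eq_square mult_ac)
    then show ?thesis
      using M0 unfolding y_def[symmetric] by (cases "norm y = 0") (auto simp: mult_le_cancel_right)
  qed
  then show ?thesis using M0 unfolding M_def by (intro onorm_bound)
qed

end
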